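(* Let $K$ be a nonempty compact metric space and let $X=(X(t))_{t\in K}$ be a centred Gaussian process, regarded as a measurable $C(K)$-valued random element, with covariance kernel $R(s,t)=\mathbb E\{X(s)X(t)\}$. Let $M=\min_{t\in K}X(t)$ and let $\sigma_*^2=\min_{\mu\in\mathcal M_1(K)}\iint_{K^2}R(s,t)\,\mu(ds)\mu(dt)$ be the minimum covariance energy. If $\sigma_*^2>0$, then, as $u\to\infty$, the conditional law of $u(M-u)$ given $M>u$ converges weakly to the law of $\sigma_*^2\xi_1$, where $\xi_1$ is a unit exponential random variable: \[ \mathcal L\bigl(u(M-u)\mid M>u\bigr)\Longrightarrow \mathcal L(\sigma_*^2\xi_1),\qquad u\to\infty . \]
   Context: $C(K)$ is the space of real continuous functions on $K$ with the supremum norm; in particular $X$ has continuous sample paths, and $R$ is continuous on $K^2$. $\mathcal M_1(K)$ denotes the set of Borel probability measures on $K$; the minimum defining $\sigma_*^2$ is attained by weak compactness and continuity. $\mathcal L(V)$ denotes the law of a random element $V$, $\mathcal L(V\mid A)$ its conditional law given an event $A$ of positive probability, and $\Longrightarrow$ denotes weak convergence. When $\sigma_*^2>0$ one has $\mathbb P\{M>u\}>0$ for every $u\in\mathbb R$, so the conditional laws are well defined. *)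

theory Defs
  imports "HOL-Probability.Probability"
begin

text \<open>
  The compact metric space \<open>K\<close> is the universe of a type of class \<^class>\<open>metric_space\<close>, subject
  to \<open>compact (UNIV :: 'k set)\<close>; it is nonempty because types are. Then \<open>'k \<Rightarrow>\<^sub>C real\<close>
  consists of all continuous functions on \<open>K\<close>, with the supremum metric and its Borel sets.
\<close>

text \<open>
  The normal law with mean \<open>m\<close> and standard deviation \<open>s \<ge> 0\<close>. Degenerate laws count as Gaussian:
  the covariance matrices of a Gaussian process may be singular.
\<close>

definition gaussian_law :: "real \<Rightarrow> real \<Rightarrow> real measure" where
  "gaussian_law m s =
     (if s = 0 then return borel m else density lborel (\<lambda>x. ennreal (normal_density m s x)))"

definition gaussian_process :: "'w measure \<Rightarrow> ('w \<Rightarrow> 'k \<Rightarrow> real) \<Rightarrow> bool" where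
  "gaussian_process P X \<longleftrightarrow>
     (\<forall>t. (\<lambda>\<omega>. X \<omega> t) \<in> borel_measurable P) \<and>
     (\<forall>T c. finite T \<longrightarrow>
       (\<exists>m s. 0 \<le> s \<and> distr P borel (\<lambda>\<omega>. \<Sum>t\<in>T. c t * X \<omega> t) = gaussian_law m s))"

definition centred_gaussian_process :: "'w measure \<Rightarrow> ('w \<Rightarrow> 'k \<Rightarrow> real) \<Rightarrow> bool" where
  "centred_gaussian_process P X \<longleftrightarrow>
     gaussian_process P X \<and> (\<forall>t. (\<integral>\<omega>. X \<omega> t \<partial>P) = 0)"

definition covariance_kernel :: "'w measure \<Rightarrow> ('w \<Rightarrow> 'k \<Rightarrow> real) \<Rightarrow> 'k \<Rightarrow> 'k \<Rightarrow> real" where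
  "covariance_kernel P X s t = (\<integral>\<omega>. X \<omega> s * X \<omega> t \<partial>P)"

definition borel_prob_measures :: "'k::topological_space measure set" where
  "borel_prob_measures = {\<mu>. prob_space \<mu> \<and> sets \<mu> = sets borel}"

definition energy :: "('k \<Rightarrow> 'k \<Rightarrow> real) \<Rightarrow> 'k measure \<Rightarrow> real" where
  "energy R \<mu> = (\<integral>t. (\<integral>s. R s t \<partial>\<mu>) \<partial>\<mu>)"

text \<open>
  Both minima below are written as infima; they are attained when \<open>K\<close> is compact and the path,
  respectively the kernel, is continuous.
\<close>

definition min_energy :: "('k::topological_space \<Rightarrow> 'k \<Rightarrow> real) \<Rightarrow> real" where
  "min_energy R = (INF \<mu>\<in>borel_prob_measures. energy R \<mu>)"

definition path_min :: "('k::topological_space \<Rightarrow>\<^sub>C real) \<Rightarrow> real" where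
  "path_min x = (INF t. apply_bcontfun x t)"

lemma min_energy_eqI:
  assumes "\<mu> \<in> borel_prob_measures"
    and "\<And>\<nu>. \<nu> \<in> borel_prob_measures \<Longrightarrow> energy R \<mu> \<le> energy R \<nu>"
  shows "min_energy R = energy R \<mu>"
  unfolding min_energy_def using assms by (intro cInf_eq_minimum) auto

lemma path_min_attained:
  fixes x :: "'k::topological_space \<Rightarrow>\<^sub>C real"
  assumes "compact (UNIV :: 'k set)"
  obtains t where "path_min x = apply_bcontfun x t" "\<And>s. apply_bcontfun x t \<le> apply_bcontfun x s"
proof -
  obtain t where t: "\<And>s. apply_bcontfun x t \<le> apply_bcontfun x s"
    using continuous_attains_inf[OF assms UNIV_not_empty, of "apply_bcontfun x"] by auto
  have "path_min x = apply_bcontfun x t"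
    unfolding path_min_def using t by (intro cInf_eq_minimum) auto
  with t show thesis by (rule that[rotated])
qed

text \<open>
  \<^const>\<open>uniform_measure\<close> \<open>P A\<close> is the conditional probability \<open>B \<mapsto> P (A \<inter> B) / P A\<close>.
\<close>

definition cond_law :: "'w measure \<Rightarrow> ('w \<Rightarrow> real) \<Rightarrow> ('w \<Rightarrow> bool) \<Rightarrow> real measure" where
  "cond_law P V A = distr (uniform_measure P {\<omega> \<in> space P. A \<omega>}) borel V"

text \<open>
  \<^const>\<open>weak_conv_m\<close> only covers sequences, so weak convergence along an arbitrary filter is
  defined by bounded continuous test functions.
\<close>

definition weak_conv_along ::
    "('i \<Rightarrow> 'a::topological_space measure) \<Rightarrow> 'a measure \<Rightarrow> 'i filter \<Rightarrow> bool" where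
  "weak_conv_along \<mu> \<nu> F \<longleftrightarrow>
     (\<forall>f :: 'a \<Rightarrow> real. continuous_on UNIV f \<and> bounded (range f) \<longrightarrow>
        ((\<lambda>i. \<integral>x. f x \<partial>\<mu> i) \<longlongrightarrow> (\<integral>x. f x \<partial>\<nu>)) F)"

lemma weak_conv_along_sequentially:
  assumes "\<And>n. real_distribution (\<mu> n)" "real_distribution \<nu>"
  shows "weak_conv_along \<mu> \<nu> sequentially \<longleftrightarrow> weak_conv_m \<mu> \<nu>"
proof
  assume w: "weak_conv_along \<mu> \<nu> sequentially"
  show "weak_conv_m \<mu> \<nu>"
  proof (rule integral_bdd_continuous_conv_imp_weak_conv[OF assms])
    fix f :: "real \<Rightarrow> real"
    assume f: "\<And>x. isCont f x" "\<And>x. \<bar>f x\<bar> \<le> 1"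
    have "bounded (range f)"
      using f(2) by (auto simp: bounded_iff)
    with f(1) w show "(\<lambda>n. integral\<^sup>L (\<mu> n) f) \<longlonglongrightarrow> integral\<^sup>L \<nu> f"
      by (auto simp: weak_conv_along_def continuous_on_eq_continuous_at)
  qed
next
  assume w: "weak_conv_m \<mu> \<nu>"
  show "weak_conv_along \<mu> \<nu> sequentially"
    unfolding weak_conv_along_def
  proof (intro allI impI)
    fix f :: "real \<Rightarrow> real"
    assume f: "continuous_on UNIV f \<and> bounded (range f)"
    then obtain B where "\<And>x. norm (f x) \<le> B"
      by (auto simp: bounded_iff)
    with f show "(\<lambda>n. \<integral>x. f x \<partial>\<mu> n) \<longlonglongrightarrow> (\<integral>x. f x \<partial>\<nu>)"
      by (intro weak_conv_imp_integral_bdd_continuous_conv[OF assms w])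
         (auto simp: continuous_on_eq_continuous_at)
  qed
qed

end

theory Submission
  imports Defs
begin

text \<open>
  Let \<open>H v = P (X \<ge> v everywhere)\<close>. A finitely supported probability measure \<open>w\<close> whose energy is
  within a factor \<open>1 + \<kappa>\<close> of the minimum \<open>\<sigma>\<^sup>2\<close> can be chosen such that its potential is at least
  \<open>1 - \<kappa>\<close> times its energy everywhere. Regressing \<open>X\<close> on \<open>Y = \<Sum> w\<^sub>t X\<^sub>t\<close> gives \<open>X = Z + g Y\<close> with
  \<open>g \<ge> 1 - \<kappa>\<close> and \<open>Z\<close> independent of \<open>Y\<close>, so \<open>H v\<close> is the mean of the Gaussian tail of \<open>Y\<close> at the
  random threshold \<open>thr v = sup (v - Z) / g\<close>. Because \<open>w\<close> averages \<open>Z\<close> to \<open>0\<close> and \<open>g\<close> to \<open>1\<close>,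
  \<open>thr v \<ge> v\<close>. Raising the level by \<open>\<delta>\<close> raises the threshold by at most \<open>\<delta> / (1 - \<kappa>)\<close>, and by at
  least \<open>\<delta> / (1 + 2\<epsilon>)\<close> unless \<open>|Z|\<close> exceeds \<open>\<epsilon>v\<close> somewhere: where \<open>g\<close> is larger than \<open>1 + 2\<epsilon>\<close>, the constraint is
  then slack. The explicit shift behaviour of Gaussian tails thus pins down \<open>H (u + x / u) / H u\<close> up to
  the events \<open>Y > (1 + \<epsilon>) u\<close> and \<open>|Z| > \<epsilon>u\<close>, which are negligible compared with \<open>H u\<close> for small \<open>\<kappa>\<close>;
  for the second one this is Fernique's tail bound for \<open>X\<close>, whose constants do not depend on \<open>\<kappa>\<close>.
\<close>

section \<open>Uniqueness of the law of a process from characteristic functions\<close>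

text \<open>On the scale \<open>1 / u\<close> the limit is exponential because a Gaussian density
  near height \<open>u\<close> decays locally at rate \<open>u / sd\<^sup>2\<close>. The obstacle is
  that \<open>H u\<close> is itself exponentially small, so every discarded event has to be beaten
  on the exponential scale. Confining \<open>X\<close> to an event of probability at least one half
  bounds \<open>H u\<close> below with leading exponent
  \<open>u\<^sup>2 / (2 * (1 - \<kappa>)\<^sup>2 * sd\<^sup>2)\<close>. A value of \<open>Y\<close>
  above \<open>(1 + \<epsilon>) * u\<close> costs a factor \<open>(1 + \<epsilon>)\<^sup>2\<close>
  in the exponent of \<open>Y\<close>; a residual above \<open>\<epsilon> * u\<close> costs an extra
  \<open>\<beta> * u\<^sup>2\<close> on top of \<open>Y \<ge> u\<close>. Both margins are set by
  \<epsilon> and survive for small \<kappa>. This fixes the order of choices: \<epsilon>, Fernique's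
  rate \<beta>, then \<kappa>, then \<open>Y\<close>, then large \<open>u\<close>; only at the end
  does \<epsilon> tend to 0. Finite support of the weights keeps \<open>Y\<close> among the linear
  combinations whose laws are Gaussian by definition.\<close>

text \<open>Normalising each weight to a probability density reduces this to Levy's uniqueness
  theorem on the line; the equation at \<open>a = 0\<close> shows that the two masses agree. General
  weights are allowed because the multivariate induction absorbs the coordinates already treated
  into the weight.\<close>

lemma weighted_char_unique:
  fixes V :: "'a \<Rightarrow> real" and V' :: "'b \<Rightarrow> real"
  assumes V[measurable]: "V \<in> borel_measurable P" "V' \<in> borel_measurable Q"
    and W: "integrable P W" "\<And>\<omega>. 0 \<le> W \<omega>" "integrable Q W'" "\<And>\<omega>. 0 \<le> W' \<omega>"
    and eq: "\<And>a. (\<integral>\<omega>. of_real (W \<omega>) * iexp (a * V \<omega>) \<partial>P) = (\<integral>\<omega>. of_real (W' \<omega>) * iexp (a * V' \<omega>) \<partial>Q)"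
    and B: "B \<in> sets borel"
  shows "(\<integral>\<omega>. W \<omega> * indicator B (V \<omega>) \<partial>P) = (\<integral>\<omega>. W' \<omega> * indicator B (V' \<omega>) \<partial>Q)"
proof -
  have norm: "real_distribution (distr (density M (\<lambda>\<omega>. ennreal (U \<omega> / c))) borel Y)"
    "char (distr (density M (\<lambda>\<omega>. ennreal (U \<omega> / c))) borel Y) a = (\<integral>\<omega>. of_real (U \<omega>) * iexp (a * Y \<omega>) \<partial>M) / of_real c"
    "measure (distr (density M (\<lambda>\<omega>. ennreal (U \<omega> / c))) borel Y) B = (\<integral>\<omega>. U \<omega> * indicator B (Y \<omega>) \<partial>M) / c"
    if M[measurable]: "Y \<in> borel_measurable M" and U: "integrable M U" "\<And>\<omega>. 0 \<le> U \<omega>" 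
      and c: "c = (\<integral>\<omega>. U \<omega> \<partial>M)" "0 < c"
    for M :: "'z measure" and Y :: "'z \<Rightarrow> real" and U c a
  proof -
    have [measurable]: "U \<in> borel_measurable M" using U by auto
    let ?D = "density M (\<lambda>\<omega>. ennreal (U \<omega> / c))"
    have e: "(\<integral>\<^sup>+\<omega>. ennreal (U \<omega> / c) \<partial>M) = 1"
      using U c by (subst nn_integral_eq_integral) auto
    have "emeasure ?D (space ?D) = 1"
      using e by (simp add: emeasure_density)
    then interpret D: prob_space ?D by (rule prob_spaceI)
    have rd: "real_distribution (distr ?D borel Y)"
      by (rule D.real_distribution_distr) (use M(1) in \<open>simp add: measurable_def\<close>)
    then show "real_distribution (distr ?D borel Y)" .
    interpret real_distribution "distr ?D borel Y" by (rule rd)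
    have "char (distr ?D borel Y) a = (\<integral>\<omega>. (U \<omega> / c) *\<^sub>R iexp (a * Y \<omega>) \<partial>M)"
      unfolding char_def using U(2) c(2)
      by (subst integral_distr, simp, simp, subst integral_density) auto
    also have "\<dots> = (\<integral>\<omega>. of_real (U \<omega>) * iexp (a * Y \<omega>) / of_real c \<partial>M)"
      by (simp add: scaleR_conv_of_real)
    finally show "char (distr ?D borel Y) a = (\<integral>\<omega>. of_real (U \<omega>) * iexp (a * Y \<omega>) \<partial>M) / of_real c"
      by (simp only: integral_divide_zero)
    have "measure (distr ?D borel Y) B = (\<integral>x. indicator B x \<partial>distr ?D borel Y)"
      using B by simp
    also have "\<dots> = (\<integral>\<omega>. (U \<omega> / c) *\<^sub>R indicator B (Y \<omega>) \<partial>M)"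
      using U(2) c(2) B by (subst integral_distr, simp, simp, subst integral_density) auto
    also have "\<dots> = (\<integral>\<omega>. U \<omega> * indicator B (Y \<omega>) / c \<partial>M)"
      by simp
    also have "\<dots> = (\<integral>\<omega>. U \<omega> * indicator B (Y \<omega>) \<partial>M) / c"
      by (rule integral_divide_zero)
    finally show "measure (distr ?D borel Y) B = (\<integral>\<omega>. U \<omega> * indicator B (Y \<omega>) \<partial>M) / c" .
  qed
  let ?c = "\<integral>\<omega>. W \<omega> \<partial>P"
  have c: "?c = (\<integral>\<omega>. W' \<omega> \<partial>Q)"
    using eq[of 0] by simp
  show ?thesis
  proof (cases "?c = 0")
    \<comment> \<open>A weight of mass zero cannot be normalised, but it vanishes almost
      everywhere.\<close>
    case True
    have "AE \<omega> in P. W \<omega> = 0"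
      using integral_nonneg_eq_0_iff_AE[of P W] True W by simp
    moreover have "AE \<omega> in Q. W' \<omega> = 0"
      using integral_nonneg_eq_0_iff_AE[of Q W'] True c W by simp
    ultimately have "(\<integral>\<omega>. W \<omega> * indicator B (V \<omega>) \<partial>P) = 0" "(\<integral>\<omega>. W' \<omega> * indicator B (V' \<omega>) \<partial>Q) = 0"
      by (auto intro!: integral_eq_zero_AE elim!: eventually_mono)
    then show ?thesis by simp
  next
    case False
    moreover have "?c \<ge> 0" using W(2) by simp
    ultimately have pos: "?c > 0" by simp
    note n1 = norm[OF V(1) W(1,2) refl pos] and n2 = norm[OF V(2) W(3,4) c pos]
    have "distr (density P (\<lambda>\<omega>. ennreal (W \<omega> / ?c))) borel V = distr (density Q (\<lambda>\<omega>. ennreal (W' \<omega> / ?c))) borel V'"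
      by (rule Levy_uniqueness[OF n1(1) n2(1)]) (rule ext, simp only: n1(2) n2(2) eq)
    with n1(3) n2(3) pos show ?thesis by simp
  qed
qed

lemma integrable_mult_bounded_comp:
  fixes U :: "'a \<Rightarrow> real" and f :: "real \<Rightarrow> real"
  assumes [measurable]: "Y \<in> borel_measurable M" "f \<in> borel_measurable borel"
    and U: "integrable M U" and f: "\<And>x. \<bar>f x\<bar> \<le> C"
  shows "integrable M (\<lambda>\<omega>. U \<omega> * f (Y \<omega>))"
proof (rule Bochner_Integration.integrable_bound)
  show "integrable M (\<lambda>\<omega>. C * U \<omega>)" using U by simp
  show "AE \<omega> in M. norm (U \<omega> * f (Y \<omega>)) \<le> norm (C * U \<omega>)"
  proof (intro always_eventually allI)
    fix \<omega> have "\<bar>f (Y \<omega>)\<bar> \<le> \<bar>C\<bar>" using f[of "Y \<omega>"] by linarith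
    then show "norm (U \<omega> * f (Y \<omega>)) \<le> norm (C * U \<omega>)"
      by (simp add: abs_mult mult.commute[of "\<bar>U \<omega>\<bar>"] mult_right_mono)
  qed
qed (use U in measurable)

text \<open>
  Levy's theorem is available in dimension one only. The nonnegative weights \<open>1 + cos S\<close> and
  \<open>1 + sin S\<close>, with \<open>S\<close> a linear combination of the remaining coordinates, reduce the joint law to it,
  one coordinate at a time.
\<close>

lemma weighted_multi_char_unique:
  fixes V :: "'a \<Rightarrow> 'i \<Rightarrow> real" and V' :: "'b \<Rightarrow> 'i \<Rightarrow> real"
  assumes T: "finite T"
    and V[measurable]: "\<And>i. (\<lambda>\<omega>. V \<omega> i) \<in> borel_measurable P" "\<And>i. (\<lambda>\<omega>. V' \<omega> i) \<in> borel_measurable Q"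
    and "integrable P W" "\<And>\<omega>. 0 \<le> W \<omega>" "integrable Q W'" "\<And>\<omega>. 0 \<le> W' \<omega>"
    and "\<And>c. (\<integral>\<omega>. of_real (W \<omega>) * iexp (\<Sum>i\<in>T. c i * V \<omega> i) \<partial>P) = (\<integral>\<omega>. of_real (W' \<omega>) * iexp (\<Sum>i\<in>T. c i * V' \<omega> i) \<partial>Q)"
    and B[measurable]: "\<And>i. B i \<in> sets borel"
  shows "(\<integral>\<omega>. W \<omega> * (\<Prod>i\<in>T. indicator (B i) (V \<omega> i)) \<partial>P) = (\<integral>\<omega>. W' \<omega> * (\<Prod>i\<in>T. indicator (B i) (V' \<omega> i)) \<partial>Q)"
  using T assms(4-8)
proof (induction T arbitrary: W W' rule: finite_induct)
  case empty
  show ?case using empty.prems(5)[of "\<lambda>_. 0"] by simp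
next
  case (insert j T)
  note W = insert.prems(1-4) and eq = insert.prems(5)
  have Wm[measurable]: "W \<in> borel_measurable P" "W' \<in> borel_measurable Q"
    using W by auto
  have eq': "(\<integral>\<omega>. of_real (W \<omega>) * iexp (a * V \<omega> j + (\<Sum>i\<in>T. c i * V \<omega> i)) \<partial>P)
    = (\<integral>\<omega>. of_real (W' \<omega>) * iexp (a * V' \<omega> j + (\<Sum>i\<in>T. c i * V' \<omega> i)) \<partial>Q)" for a c
  proof -
    have "(\<Sum>i\<in>T. (c(j := a)) i * f i) = (\<Sum>i\<in>T. c i * f i)" for f
      using insert.hyps by (intro sum.cong) auto
    with eq[of "c(j := a)"] insert.hyps show ?thesis
      by (simp del: of_real_sum of_real_add of_real_mult fun_upd_apply add: fun_upd_same)
  qed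
  have int: "integrable M (\<lambda>\<omega>. complex_of_real (U \<omega>) * iexp (Y \<omega>))"
    if "integrable M U" "Y \<in> borel_measurable M" for M :: "'z measure" and U Y
    by (rule Bochner_Integration.integrable_bound[OF that(1)]) (use that in \<open>auto simp: norm_mult\<close>)
  note wcu = weighted_char_unique[OF V(1)[of j] V(2)[of j]]
  have base: "(\<integral>\<omega>. W \<omega> * indicator (B j) (V \<omega> j) \<partial>P) = (\<integral>\<omega>. W' \<omega> * indicator (B j) (V' \<omega> j) \<partial>Q)"
    by (rule wcu[OF W]) (use eq'[of _ "\<lambda>_. 0"] in auto)
  \<comment> \<open>Multiplying the weight by \<open>1 + f S\<close> keeps it nonnegative. Since
    \<open>f\<close> is a combination of two exponentials, the new characteristic integral splits
    into three joint ones, each covered by \<open>eq'\<close>; afterwards \<open>base\<close>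
    removes the contribution of the summand 1.\<close>
  have trig: "(\<integral>\<omega>. (W \<omega> * indicator (B j) (V \<omega> j)) * f (\<Sum>i\<in>T. c i * V \<omega> i) \<partial>P)
     = (\<integral>\<omega>. (W' \<omega> * indicator (B j) (V' \<omega> j)) * f (\<Sum>i\<in>T. c i * V' \<omega> i) \<partial>Q)"
    if f: "f \<in> borel_measurable borel" "\<And>x. \<bar>f x\<bar> \<le> 1" "\<And>x. complex_of_real (f x) = \<alpha> * iexp x + \<beta> * iexp (- x)" for c f \<alpha> \<beta>
  proof -
    note f(1)[measurable]
    have *: "(\<integral>\<omega>. of_real (U \<omega> * (1 + f (\<Sum>i\<in>T. c i * Y \<omega> i))) * iexp (a * Y \<omega> j) \<partial>M)
      = (\<integral>\<omega>. of_real (U \<omega>) * iexp (a * Y \<omega> j) \<partial>M) 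
       + \<alpha> * (\<integral>\<omega>. of_real (U \<omega>) * iexp (a * Y \<omega> j + (\<Sum>i\<in>T. c i * Y \<omega> i)) \<partial>M)
       + \<beta> * (\<integral>\<omega>. of_real (U \<omega>) * iexp (a * Y \<omega> j + (\<Sum>i\<in>T. - c i * Y \<omega> i)) \<partial>M)"
      if "integrable M U" and [measurable]: "\<And>i. (\<lambda>\<omega>. Y \<omega> i) \<in> borel_measurable M" for M :: "'z measure" and U Y a
    proof -
      have "(\<integral>\<omega>. of_real (U \<omega> * (1 + f (\<Sum>i\<in>T. c i * Y \<omega> i))) * iexp (a * Y \<omega> j) \<partial>M)
       = (\<integral>\<omega>. of_real (U \<omega>) * iexp (a * Y \<omega> j) + \<alpha> * (of_real (U \<omega>) * iexp (a * Y \<omega> j + (\<Sum>i\<in>T. c i * Y \<omega> i)))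
           + \<beta> * (of_real (U \<omega>) * iexp (a * Y \<omega> j + (\<Sum>i\<in>T. - c i * Y \<omega> i))) \<partial>M)"
        by (intro Bochner_Integration.integral_cong refl)
          (simp add: f(3) sum_negf algebra_simps exp_add exp_diff exp_minus divide_inverse)
      then show ?thesis
        using that by (simp add: int del: of_real_sum of_real_add of_real_mult)
    qed
    have nn: "0 \<le> 1 + f x" for x using f(2)[of x] by linarith
    have ab: "\<bar>1 + f x\<bar> \<le> 2" for x using f(2)[of x] by linarith
    have "(\<integral>\<omega>. (W \<omega> * (1 + f (\<Sum>i\<in>T. c i * V \<omega> i))) * indicator (B j) (V \<omega> j) \<partial>P)
     = (\<integral>\<omega>. (W' \<omega> * (1 + f (\<Sum>i\<in>T. c i * V' \<omega> i))) * indicator (B j) (V' \<omega> j) \<partial>Q)"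
    proof (rule wcu)
      show "integrable P (\<lambda>\<omega>. W \<omega> * (1 + f (\<Sum>i\<in>T. c i * V \<omega> i)))"
        using integrable_mult_bounded_comp[of "\<lambda>\<omega>. \<Sum>i\<in>T. c i * V \<omega> i" P "\<lambda>x. 1 + f x", OF _ _ W(1) ab] by simp
      show "integrable Q (\<lambda>\<omega>. W' \<omega> * (1 + f (\<Sum>i\<in>T. c i * V' \<omega> i)))"
        using integrable_mult_bounded_comp[of "\<lambda>\<omega>. \<Sum>i\<in>T. c i * V' \<omega> i" Q "\<lambda>x. 1 + f x", OF _ _ W(3) ab] by simp
      have "(\<integral>\<omega>. of_real (W \<omega>) * iexp (a * V \<omega> j) \<partial>P) = (\<integral>\<omega>. of_real (W' \<omega>) * iexp (a * V' \<omega> j) \<partial>Q)" for a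
        using eq'[of _ "\<lambda>_. 0"] by simp
      then show "(\<integral>\<omega>. of_real (W \<omega> * (1 + f (\<Sum>i\<in>T. c i * V \<omega> i))) * iexp (a * V \<omega> j) \<partial>P)
        = (\<integral>\<omega>. of_real (W' \<omega> * (1 + f (\<Sum>i\<in>T. c i * V' \<omega> i))) * iexp (a * V' \<omega> j) \<partial>Q)" for a
        using *[of P W V, OF W(1) V(1)] *[of Q W' V', OF W(3) V(2)] by (simp only: eq')
    qed (use W nn in auto)
    moreover have **: "(\<integral>\<omega>. (U \<omega> * (1 + f (\<Sum>i\<in>T. c i * Y \<omega> i))) * indicator (B j) (Y \<omega> j) \<partial>M)
      = (\<integral>\<omega>. U \<omega> * indicator (B j) (Y \<omega> j) \<partial>M) + (\<integral>\<omega>. (U \<omega> * indicator (B j) (Y \<omega> j)) * f (\<Sum>i\<in>T. c i * Y \<omega> i) \<partial>M)"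
      if "integrable M U" and [measurable]: "\<And>i. (\<lambda>\<omega>. Y \<omega> i) \<in> borel_measurable M" for M :: "'z measure" and U Y
    proof -
      have i: "integrable M (\<lambda>\<omega>. U \<omega> * indicator (B j) (Y \<omega> j))"
        by (rule integrable_mult_bounded_comp[of "\<lambda>\<omega>. Y \<omega> j" _ _ _ 1, OF _ _ that(1)]) (auto simp: indicator_def)
      have i2: "integrable M (\<lambda>\<omega>. (U \<omega> * indicator (B j) (Y \<omega> j)) * f (\<Sum>i\<in>T. c i * Y \<omega> i))"
        by (rule integrable_mult_bounded_comp[of "\<lambda>\<omega>. (\<Sum>i\<in>T. c i * Y \<omega> i)", OF _ _ i f(2)]) auto
      show ?thesis
        by (subst Bochner_Integration.integral_add[OF i i2, symmetric]) (simp add: algebra_simps)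
    qed
    ultimately show ?thesis
      using base by (simp only: **[of P W V, OF W(1) V(1)] **[of Q W' V', OF W(3) V(2)] add_left_cancel)
  qed
  have cos: "(\<integral>\<omega>. (W \<omega> * indicator (B j) (V \<omega> j)) * cos (\<Sum>i\<in>T. c i * V \<omega> i) \<partial>P)
     = (\<integral>\<omega>. (W' \<omega> * indicator (B j) (V' \<omega> j)) * cos (\<Sum>i\<in>T. c i * V' \<omega> i) \<partial>Q)" for c
    by (rule trig[of cos "1/2" "1/2"]) (auto simp: complex_eq_iff Re_exp Im_exp)
  have sin: "(\<integral>\<omega>. (W \<omega> * indicator (B j) (V \<omega> j)) * sin (\<Sum>i\<in>T. c i * V \<omega> i) \<partial>P)
     = (\<integral>\<omega>. (W' \<omega> * indicator (B j) (V' \<omega> j)) * sin (\<Sum>i\<in>T. c i * V' \<omega> i) \<partial>Q)" for c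
    by (rule trig[of sin "-\<i>/2" "\<i>/2"]) (auto simp: complex_eq_iff Re_exp Im_exp)
  let ?W = "\<lambda>\<omega>. W \<omega> * indicator (B j) (V \<omega> j)" and ?W' = "\<lambda>\<omega>. W' \<omega> * indicator (B j) (V' \<omega> j)"
  have iW: "integrable P ?W" "integrable Q ?W'"
    using integrable_mult_bounded_comp[of "\<lambda>\<omega>. V \<omega> j" P "indicator (B j)" _ 1, OF _ _ W(1)]
      integrable_mult_bounded_comp[of "\<lambda>\<omega>. V' \<omega> j" Q "indicator (B j)" _ 1, OF _ _ W(3)] by (auto simp: indicator_def)
  have split: "(\<integral>\<omega>. of_real (U \<omega>) * iexp (Y \<omega>) \<partial>M) = of_real (\<integral>\<omega>. U \<omega> * cos (Y \<omega>) \<partial>M) + \<i> * of_real (\<integral>\<omega>. U \<omega> * sin (Y \<omega>) \<partial>M)"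
    if "integrable M U" and [measurable]: "Y \<in> borel_measurable M" for M :: "'z measure" and U Y
  proof -
    have "integrable M (\<lambda>\<omega>. U \<omega> * cos (Y \<omega>))" "integrable M (\<lambda>\<omega>. U \<omega> * sin (Y \<omega>))"
      by (rule integrable_mult_bounded_comp[where C=1], use that in auto)+
    moreover have "of_real (U \<omega>) * iexp (Y \<omega>) = complex_of_real (U \<omega> * cos (Y \<omega>)) + \<i> * complex_of_real (U \<omega> * sin (Y \<omega>))" for \<omega>
      by (auto simp: complex_eq_iff Re_exp Im_exp)
    ultimately show ?thesis by (simp del: of_real_mult)
  qed
  \<comment> \<open>The induction hypothesis is applied to the weight that already carries the
    indicator of coordinate \<open>j\<close>; its characteristic integrals are reassembled from
    \<open>cos\<close> and \<open>sin\<close>.\<close>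
  have "(\<integral>\<omega>. ?W \<omega> * (\<Prod>i\<in>T. indicator (B i) (V \<omega> i)) \<partial>P) = (\<integral>\<omega>. ?W' \<omega> * (\<Prod>i\<in>T. indicator (B i) (V' \<omega> i)) \<partial>Q)"
    by (rule insert.IH[OF iW(1) _ iW(2)]) (use W iW cos sin in \<open>auto simp: split simp del: of_real_mult of_real_sum\<close>)
  then show ?case using insert.hyps by (simp add: mult.assoc)
qed

text \<open>Finite-dimensional boxes determine a probability measure on the product sigma-algebra,
  so the index set may be uncountable.\<close>

lemma process_law_eqI:
  fixes V :: "'a \<Rightarrow> 'i \<Rightarrow> real" and V' :: "'b \<Rightarrow> 'i \<Rightarrow> real"
  assumes P: "prob_space P" "prob_space Q"
    and V[measurable]: "\<And>i. (\<lambda>\<omega>. V \<omega> i) \<in> borel_measurable P" "\<And>i. (\<lambda>\<omega>. V' \<omega> i) \<in> borel_measurable Q"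
    and eq: "\<And>T c. finite T \<Longrightarrow> (\<integral>\<omega>. iexp (\<Sum>i\<in>T. c i * V \<omega> i) \<partial>P) = (\<integral>\<omega>. iexp (\<Sum>i\<in>T. c i * V' \<omega> i) \<partial>Q)"
  shows "distr P (PiM UNIV (\<lambda>_. borel)) V = distr Q (PiM UNIV (\<lambda>_. borel)) V'"
proof -
  interpret P: prob_space P by fact
  interpret Q: prob_space Q by fact
  have [measurable]: "V \<in> measurable P (PiM UNIV (\<lambda>_. borel))" "V' \<in> measurable Q (PiM UNIV (\<lambda>_. borel))"
    by (auto intro!: measurable_PiM_single')
  interpret D: prob_space "distr P (PiM UNIV (\<lambda>_. borel)) V"
    by (rule P.prob_space_distr) simp
  show ?thesis
  proof (rule measure_eqI_PiM_infinite)
    fix A and J :: "'i set" assume J: "finite J" "J \<subseteq> UNIV" and A: "\<And>i. i \<in> J \<Longrightarrow> A i \<in> sets (borel :: real measure)"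
    \<comment> \<open>Outside \<open>J\<close> the sets \<open>A i\<close> may fail to be
      measurable; the empty set makes the family measurable everywhere without affecting products
      over \<open>J\<close>.\<close>
    define B where "B i = (if i \<in> J then A i else {})" for i
    have B[measurable]: "B i \<in> sets borel" for i using A by (auto simp: B_def)
    have pe: "prod_emb UNIV (\<lambda>_. borel) J (Pi\<^sub>E J A) = {v. \<forall>i\<in>J. v i \<in> B i}"
      by (auto simp: prod_emb_def B_def space_PiM PiE_iff)
    have st: "measure M (Y -` {v. \<forall>i\<in>J. v i \<in> B i} \<inter> space M) = (\<integral>\<omega>. 1 * (\<Prod>i\<in>J. indicator (B i) (Y \<omega> i)) \<partial>M)"
      if "prob_space M" "Y \<in> measurable M (PiM UNIV (\<lambda>_. borel))" for M :: "'z measure" and Y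
    proof -
      have "(\<Prod>i\<in>J. indicator (B i) (Y \<omega> i)) = (indicator {\<omega>. \<forall>i\<in>J. Y \<omega> i \<in> B i} \<omega> :: real)" for \<omega>
        using J by (auto simp: indicator_def)
      then show ?thesis by (simp add: vimage_def)
    qed
    have meas: "{v. \<forall>i\<in>J. v i \<in> B i} \<in> sets (PiM UNIV (\<lambda>_. borel))"
      unfolding pe[symmetric] using J A by (intro sets_PiM_I) auto
    have "(\<integral>\<omega>. 1 * (\<Prod>i\<in>J. indicator (B i) (V \<omega> i) :: real) \<partial>P) = (\<integral>\<omega>. 1 * (\<Prod>i\<in>J. indicator (B i) (V' \<omega> i)) \<partial>Q)"
      by (rule weighted_multi_char_unique[where W = "\<lambda>_. 1" and W' = "\<lambda>_. 1"]) (use J eq in auto)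
    then show "emeasure (distr P (PiM UNIV (\<lambda>_. borel)) V) (prod_emb UNIV (\<lambda>_. borel) J (Pi\<^sub>E J A)) = emeasure (distr Q (PiM UNIV (\<lambda>_. borel)) V') (prod_emb UNIV (\<lambda>_. borel) J (Pi\<^sub>E J A))"
      unfolding pe using meas
      by (simp add: emeasure_distr P.emeasure_eq_measure Q.emeasure_eq_measure st[OF P.prob_space_axioms] st[OF Q.prob_space_axioms] del: vimage_Collect_eq)
  qed (auto simp: D.finite_measure_axioms)
qed

section \<open>Gaussian linear combinations\<close>

lemma (in prob_space) gaussian_law_moments:
  assumes S[measurable]: "S \<in> borel_measurable M" and D: "distr M borel S = gaussian_law m s" and s: "0 \<le> s"
  shows "integrable M S" "expectation S = m"
    and "m = 0 \<Longrightarrow> integrable M (\<lambda>\<omega>. (S \<omega>)\<^sup>2)" "m = 0 \<Longrightarrow> expectation (\<lambda>\<omega>. (S \<omega>)\<^sup>2) = s\<^sup>2"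
    and "m = 0 \<Longrightarrow> (\<integral>\<omega>. iexp (S \<omega>) \<partial>M) = of_real (exp (- s\<^sup>2 / 2))"
proof -
  have "integrable M S \<and> expectation S = m \<and> (m = 0 \<longrightarrow> integrable M (\<lambda>\<omega>. (S \<omega>)\<^sup>2) \<and> expectation (\<lambda>\<omega>. (S \<omega>)\<^sup>2) = s\<^sup>2
     \<and> (\<integral>\<omega>. iexp (S \<omega>) \<partial>M) = of_real (exp (- s\<^sup>2 / 2)))"
  proof (cases "s = 0")
    case True
    have "AE x in distr M borel S. x = m"
      unfolding D gaussian_law_def using True by (simp add: AE_return)
    then have ae: "AE \<omega> in M. S \<omega> = m"
      by (subst (asm) AE_distr_iff) auto
    have c: "integrable M (\<lambda>\<omega>. f (S \<omega>)) \<and> (\<integral>\<omega>. f (S \<omega>) \<partial>M) = f m" if [measurable]: "f \<in> borel_measurable borel" 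
      for f :: "real \<Rightarrow> 'z::{banach, second_countable_topology}"
    proof -
      have "AE \<omega> in M. f (S \<omega>) = f m" using ae by (auto elim: eventually_mono)
      have "integrable M (\<lambda>\<omega>. f (S \<omega>)) = integrable M (\<lambda>\<omega>. f m)"
        by (rule integrable_cong_AE) (use \<open>AE \<omega> in M. f (S \<omega>) = f m\<close> in auto)
      moreover have "(\<integral>\<omega>. f (S \<omega>) \<partial>M) = (\<integral>\<omega>. f m \<partial>M)"
        by (rule integral_cong_AE) (use \<open>AE \<omega> in M. f (S \<omega>) = f m\<close> in auto)
      ultimately show ?thesis by (simp add: prob_space)
    qed
    show ?thesis
      using c[of "\<lambda>x. x"] c[of "\<lambda>x. x\<^sup>2"] c[of "\<lambda>x. iexp x"] True by auto
  next
    case False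
    with s have s: "0 < s" by simp
    have dist: "distributed M lborel S (normal_density m s)"
      using D False by (simp add: distributed_def gaussian_law_def cong: distr_cong)
    have 1: "integrable M (\<lambda>\<omega>. f (S \<omega>)) \<longleftrightarrow> integrable lborel (\<lambda>x. normal_density m s x * f x)"
            "(\<integral>\<omega>. f (S \<omega>) \<partial>M) = (\<integral>x. normal_density m s x * f x \<partial>lborel)"
      if "f \<in> borel_measurable borel" for f :: "real \<Rightarrow> real"
      using that distributed_integrable[OF dist, of f] distributed_integral[OF dist, of f] by auto
    have 2: "(\<integral>\<omega>. iexp (S \<omega>) \<partial>M) = of_real (exp (- s\<^sup>2 / 2))" if "m = 0"
    proof -
      have d: "distributed M lborel (\<lambda>\<omega>. S \<omega> / s) std_normal_density"
        using dist normal_standard_normal_convert[OF s, of S m] that by simp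
      then have "distr M borel (\<lambda>\<omega>. S \<omega> / s) = std_normal_distribution"
        by (simp add: distributed_def cong: distr_cong)
      then have "char (distr M borel (\<lambda>\<omega>. S \<omega> / s)) s = of_real (exp (- s\<^sup>2 / 2))"
        by (simp add: char_std_normal_distribution)
      then show ?thesis using s by (simp add: char_def integral_distr)
    qed
    show ?thesis
      using 1[of "\<lambda>x. x"] 1[of "\<lambda>x. x\<^sup>2"] 2 s integral_normal_moment_nz_1[OF s, of m] integrable_normal_moment_nz_1[OF s, of m]
         integrable_normal_moment[OF s, of 0 2] integral_normal_moment_even[OF s, of 0 1]
      by (auto simp: power2_eq_square)
  qed
  then show "integrable M S" "expectation S = m"
    and "m = 0 \<Longrightarrow> integrable M (\<lambda>\<omega>. (S \<omega>)\<^sup>2)" "m = 0 \<Longrightarrow> expectation (\<lambda>\<omega>. (S \<omega>)\<^sup>2) = s\<^sup>2"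
    and "m = 0 \<Longrightarrow> (\<integral>\<omega>. iexp (S \<omega>) \<partial>M) = of_real (exp (- s\<^sup>2 / 2))" by auto
qed

section \<open>The linear span of the path evaluations\<close>

locale gaussian_element = prob_space P for P :: "'w measure" +
  fixes X :: "'w \<Rightarrow> 'k::metric_space \<Rightarrow>\<^sub>C real"
  assumes compact_K: "compact (UNIV :: 'k set)"
    and X_meas[measurable]: "X \<in> borel_measurable P"
    and X_gauss: "centred_gaussian_process P (\<lambda>\<omega> t. apply_bcontfun (X \<omega>) t)"
begin

text \<open>The Gaussian space in which the path values, the average \<open>Y\<close> and the
  residuals \<open>Z t\<close> all live; the law of each member is determined by its second
  moment.\<close>

definition lincomb :: "('w \<Rightarrow> real) set" where
  "lincomb = {S. \<exists>T c. finite T \<and> S = (\<lambda>\<omega>. \<Sum>t\<in>T. c t * apply_bcontfun (X \<omega>) t)}"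

lemma lincomb_add:
  assumes "S \<in> lincomb" "S' \<in> lincomb"
  shows "(\<lambda>\<omega>. S \<omega> + S' \<omega>) \<in> lincomb"
proof -
  obtain T c T' c' where S: "finite T" "S = (\<lambda>\<omega>. \<Sum>t\<in>T. c t * apply_bcontfun (X \<omega>) t)"
    "finite T'" "S' = (\<lambda>\<omega>. \<Sum>t\<in>T'. c' t * apply_bcontfun (X \<omega>) t)"
    using assms by (auto simp: lincomb_def)
  have "(\<Sum>t\<in>T. c t * f t) = (\<Sum>t\<in>T \<union> T'. (if t \<in> T then c t else 0) * f t)"
    "(\<Sum>t\<in>T'. c' t * f t) = (\<Sum>t\<in>T \<union> T'. (if t \<in> T' then c' t else 0) * f t)" for f :: "'k \<Rightarrow> real"
    using S by (auto intro!: sum.mono_neutral_cong_left)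
  then have "(\<lambda>\<omega>. S \<omega> + S' \<omega>) = (\<lambda>\<omega>. \<Sum>t\<in>T \<union> T'. ((if t \<in> T then c t else 0) + (if t \<in> T' then c' t else 0)) * apply_bcontfun (X \<omega>) t)"
    unfolding S by (simp only: sum.distrib[symmetric] distrib_right)
  then show ?thesis using S by (auto simp: lincomb_def)
qed

lemma lincomb_scale: "S \<in> lincomb \<Longrightarrow> (\<lambda>\<omega>. a * S \<omega>) \<in> lincomb"
  unfolding lincomb_def by (force simp: sum_distrib_left mult.assoc[symmetric])

lemma lincomb_zero: "(\<lambda>\<omega>. 0) \<in> lincomb"
  unfolding lincomb_def by (auto intro!: exI[of _ "{}"])

lemma lincomb_eval: "(\<lambda>\<omega>. apply_bcontfun (X \<omega>) t) \<in> lincomb"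
  unfolding lincomb_def by (auto intro!: exI[of _ "{t}"] exI[of _ "\<lambda>_. 1"])

lemma lincomb_sum: "(\<And>i. i \<in> I \<Longrightarrow> A i \<in> lincomb) \<Longrightarrow> (\<lambda>\<omega>. \<Sum>i\<in>I. c i * A i \<omega>) \<in> lincomb"
proof (induction I rule: infinite_finite_induct)
  case (insert x F)
  then show ?case using lincomb_add[OF lincomb_scale[of "A x" "c x"]] by simp
qed (simp_all add: lincomb_zero)

lemma eval_meas[measurable]: "(\<lambda>\<omega>. apply_bcontfun (X \<omega>) t) \<in> borel_measurable P"
  using X_gauss by (auto simp: centred_gaussian_process_def gaussian_process_def)

lemma lincomb_law:
  assumes "S \<in> lincomb"
  shows "S \<in> borel_measurable P" "\<exists>s\<ge>0. distr P borel S = gaussian_law 0 s"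
proof -
  have g: "\<exists>m s. 0 \<le> s \<and> distr P borel (\<lambda>\<omega>. \<Sum>t\<in>T. c t * apply_bcontfun (X \<omega>) t) = gaussian_law m s" if "finite T" for T c
    using X_gauss that by (auto simp: centred_gaussian_process_def gaussian_process_def)
  have i: "integrable P (\<lambda>\<omega>. apply_bcontfun (X \<omega>) t)" for t
    using g[of "{t}" "\<lambda>_. 1"] by (auto intro: gaussian_law_moments(1))
  have e: "expectation (\<lambda>\<omega>. apply_bcontfun (X \<omega>) t) = 0" for t
    using X_gauss by (auto simp: centred_gaussian_process_def)
  obtain T c where S: "finite T" "S = (\<lambda>\<omega>. \<Sum>t\<in>T. c t * apply_bcontfun (X \<omega>) t)"
    using assms by (auto simp: lincomb_def)
  show m: "S \<in> borel_measurable P" unfolding S by simp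
  obtain a s where as: "0 \<le> s" "distr P borel S = gaussian_law a s" using g[OF S(1), of c] S by auto
  have "a = expectation S" using gaussian_law_moments(2)[OF m as(2,1)] by simp
  also have "\<dots> = 0" unfolding S by (simp add: i e)
  finally show "\<exists>s\<ge>0. distr P borel S = gaussian_law 0 s" using as by auto
qed

lemma lincomb_moments:
  assumes "S \<in> lincomb"
  shows "integrable P S" "integrable P (\<lambda>\<omega>. (S \<omega>)\<^sup>2)"
    and "distr P borel S = gaussian_law 0 (sqrt (expectation (\<lambda>\<omega>. (S \<omega>)\<^sup>2)))"
    and "(\<integral>\<omega>. iexp (S \<omega>) \<partial>P) = of_real (exp (- expectation (\<lambda>\<omega>. (S \<omega>)\<^sup>2) / 2))"
proof -
  obtain s where s: "s \<ge> 0" "distr P borel S = gaussian_law 0 s" using lincomb_law(2)[OF assms] by auto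
  note m = gaussian_law_moments[OF lincomb_law(1)[OF assms] s(2,1)]
  show "integrable P S" "integrable P (\<lambda>\<omega>. (S \<omega>)\<^sup>2)" 
    "distr P borel S = gaussian_law 0 (sqrt (expectation (\<lambda>\<omega>. (S \<omega>)\<^sup>2)))"
    "(\<integral>\<omega>. iexp (S \<omega>) \<partial>P) = of_real (exp (- expectation (\<lambda>\<omega>. (S \<omega>)\<^sup>2) / 2))"
    using m s by auto
qed

lemma lincomb_integrable_mult:
  assumes "S \<in> lincomb" "S' \<in> lincomb"
  shows "integrable P (\<lambda>\<omega>. S \<omega> * S' \<omega>)"
proof (rule Bochner_Integration.integrable_bound)
  show "integrable P (\<lambda>\<omega>. (S \<omega>)\<^sup>2 + (S' \<omega>)\<^sup>2)"
    using lincomb_moments(2) assms by simp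
  show "(\<lambda>\<omega>. S \<omega> * S' \<omega>) \<in> borel_measurable P"
    using assms by (intro borel_measurable_times lincomb_law(1))
  have "\<bar>a * b\<bar> \<le> a\<^sup>2 + b\<^sup>2" for a b :: real
    using sum_squares_bound[of "\<bar>a\<bar>" "\<bar>b\<bar>"] abs_ge_zero[of "a * b"] unfolding abs_mult power2_abs by linarith
  then show "AE \<omega> in P. norm (S \<omega> * S' \<omega>) \<le> norm ((S \<omega>)\<^sup>2 + (S' \<omega>)\<^sup>2)" by auto
qed

lemma expectation_sum_square:
  assumes "\<And>i. i \<in> I \<Longrightarrow> A i \<in> lincomb"
  shows "expectation (\<lambda>\<omega>. (\<Sum>i\<in>I. c i * A i \<omega>)\<^sup>2) = (\<Sum>i\<in>I. \<Sum>j\<in>I. c i * c j * expectation (\<lambda>\<omega>. A i \<omega> * A j \<omega>))"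
proof -
  have "(\<lambda>\<omega>. (\<Sum>i\<in>I. c i * A i \<omega>)\<^sup>2) = (\<lambda>\<omega>. \<Sum>i\<in>I. \<Sum>j\<in>I. c i * c j * (A i \<omega> * A j \<omega>))"
    by (simp add: power2_eq_square sum_product ac_simps)
  then show ?thesis
    using assms by (simp add: lincomb_integrable_mult)
qed

text \<open>The product space supplies two independent copies of \<open>X\<close>, so the
  characteristic function factorises and variances add.\<close>

lemma pair_char:
  assumes "S \<in> lincomb" "S' \<in> lincomb"
  shows "(\<integral>\<omega>. iexp (S (fst \<omega>) + S' (snd \<omega>)) \<partial>(P \<Otimes>\<^sub>M P)) =
    of_real (exp (- (expectation (\<lambda>\<omega>. (S \<omega>)\<^sup>2) + expectation (\<lambda>\<omega>. (S' \<omega>)\<^sup>2)) / 2))"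
proof -
  interpret PP: pair_prob_space P P ..
  note [measurable] = assms[THEN lincomb_law(1)]
  have "(\<integral>\<omega>. iexp (S (fst \<omega>) + S' (snd \<omega>)) \<partial>(P \<Otimes>\<^sub>M P)) = (\<integral>\<omega>. (\<integral>\<omega>'. iexp (S \<omega> + S' \<omega>') \<partial>P) \<partial>P)"
    by (subst PP.integral_fst'[symmetric]) 
       (auto intro!: PP.P.integrable_const_bound[where B=1] simp del: of_real_add)
  also have "\<dots> = (\<integral>\<omega>. iexp (S \<omega>) * (\<integral>\<omega>'. iexp (S' \<omega>') \<partial>P) \<partial>P)"
    by (simp add: distrib_left exp_add)
  also have "\<dots> = (\<integral>\<omega>. iexp (S \<omega>) \<partial>P) * (\<integral>\<omega>'. iexp (S' \<omega>') \<partial>P)"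
    by simp
  finally show ?thesis
    using assms by (simp add: lincomb_moments exp_add[symmetric] add_divide_distrib flip: of_real_mult exp_add)
qed

text \<open>
  Both the rotation invariance behind Fernique's theorem and the independence of a Gaussian process and
  its regression on one variable are equalities in law between sums of two independent parts.
\<close>

lemma pair_law_eqI:
  assumes L: "\<And>i. A i \<in> lincomb" "\<And>i. B i \<in> lincomb" "\<And>i. A' i \<in> lincomb" "\<And>i. B' i \<in> lincomb"
    and eq: "\<And>i j. expectation (\<lambda>\<omega>. A i \<omega> * A j \<omega>) + expectation (\<lambda>\<omega>. B i \<omega> * B j \<omega>) =
       expectation (\<lambda>\<omega>. A' i \<omega> * A' j \<omega>) + expectation (\<lambda>\<omega>. B' i \<omega> * B' j \<omega>)"
  shows "distr (P \<Otimes>\<^sub>M P) (PiM UNIV (\<lambda>_. borel)) (\<lambda>\<omega> i. A i (fst \<omega>) + B i (snd \<omega>)) =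
     distr (P \<Otimes>\<^sub>M P) (PiM UNIV (\<lambda>_. borel)) (\<lambda>\<omega> i. A' i (fst \<omega>) + B' i (snd \<omega>))"
proof (rule process_law_eqI)
  interpret PP: pair_prob_space P P ..
  show "prob_space (P \<Otimes>\<^sub>M P)" "prob_space (P \<Otimes>\<^sub>M P)" by (rule PP.P.prob_space_axioms)+
  note [measurable] = L[THEN lincomb_law(1)]
  show "(\<lambda>\<omega>. A i (fst \<omega>) + B i (snd \<omega>)) \<in> borel_measurable (P \<Otimes>\<^sub>M P)" 
    "(\<lambda>\<omega>. A' i (fst \<omega>) + B' i (snd \<omega>)) \<in> borel_measurable (P \<Otimes>\<^sub>M P)" for i by measurable
  fix T :: "'a set" and c
  have "(\<integral>\<omega>. iexp (\<Sum>i\<in>T. c i * (A i (fst \<omega>) + B i (snd \<omega>))) \<partial>(P \<Otimes>\<^sub>M P)) = 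
    of_real (exp (- (\<Sum>i\<in>T. \<Sum>j\<in>T. c i * c j * (expectation (\<lambda>\<omega>. A i \<omega> * A j \<omega>) + expectation (\<lambda>\<omega>. B i \<omega> * B j \<omega>))) / 2))"
    if "\<And>i. A i \<in> lincomb" "\<And>i. B i \<in> lincomb" for A B
    using pair_char[OF lincomb_sum[of T A c] lincomb_sum[of T B c]] that
    by (simp add: expectation_sum_square sum.distrib distrib_left del: of_real_sum of_real_add)
  then show "(\<integral>\<omega>. iexp (\<Sum>i\<in>T. c i * (A i (fst \<omega>) + B i (snd \<omega>))) \<partial>(P \<Otimes>\<^sub>M P)) = 
    (\<integral>\<omega>. iexp (\<Sum>i\<in>T. c i * (A' i (fst \<omega>) + B' i (snd \<omega>))) \<partial>(P \<Otimes>\<^sub>M P))"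
    using L eq by simp
qed

end

section \<open>Fernique's theorem and continuity of the covariance\<close>

text \<open>Events about whole paths involve uncountably many times. By continuity they can be
  tested on a countable dense set, which places them in the product sigma-algebra where laws are
  compared.\<close>

lemma compact_UNIV_countable_dense:
  assumes "compact (UNIV :: 'k::metric_space set)"
  obtains D :: "'k::metric_space set" where "countable D" "closure D = UNIV"
proof -
  have "\<exists>k. finite k \<and> (UNIV :: 'k set) \<subseteq> (\<Union>x\<in>k. ball x (1 / Suc n))" for n
    using assms by (simp add: compact_eq_totally_bounded)
  then obtain F where F: "\<And>n. finite (F n)" "\<And>n. (UNIV :: 'k set) \<subseteq> (\<Union>x\<in>F n. ball x (1 / Suc n))"
    by metis
  have "x \<in> closure (\<Union>n. F n)" for x
    unfolding closure_approachable
  proof (intro allI impI)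
    fix e :: real assume "e > 0"
    then obtain n where n: "1 / Suc n < e" using nat_approx_posE by blast
    obtain y where "y \<in> F n" "x \<in> ball y (1 / Suc n)" using F(2)[of n] by blast
    with n show "\<exists>y\<in>\<Union>n. F n. dist y x < e" by (intro bexI[of _ y]) auto
  qed
  then show thesis
    by (intro that[of "\<Union>n. F n"]) (auto intro: F countable_finite)
qed

lemma norm_bcontfun_le_iff_dense:
  fixes x :: "'k::metric_space \<Rightarrow>\<^sub>C real"
  assumes "closure D = UNIV"
  shows "norm x \<le> s \<longleftrightarrow> (\<forall>t\<in>D. \<bar>apply_bcontfun x t\<bar> \<le> s)"
proof
  assume "norm x \<le> s" then show "\<forall>t\<in>D. \<bar>apply_bcontfun x t\<bar> \<le> s"
    using norm_bounded[of x] by (auto intro: order_trans)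
next
  assume a: "\<forall>t\<in>D. \<bar>apply_bcontfun x t\<bar> \<le> s"
  have c: "continuous_on (closure D) (\<lambda>t. \<bar>apply_bcontfun x t\<bar>)"
    by (intro continuous_intros continuous_on_apply_bcontfun)
  have "\<bar>apply_bcontfun x t\<bar> \<le> s" for t
    by (rule continuous_le_on_closure[OF c, of t s]) (use a assms in auto)
  then show "norm x \<le> s" by (intro norm_bound) auto
qed

text \<open>The inequality squares the tail each time the level grows by a factor
  \<open>sqrt 2\<close>, up to a shift. Squaring under geometric growth of the level is what
  produces a Gaussian rate.\<close>

lemma fernique_iteration:
  fixes F :: "real \<Rightarrow> real"
  assumes F: "antimono F" "\<And>t. 0 \<le> F t" "\<And>t. F t \<le> 1" and s: "0 < s" "F s \<le> 1/4"
    and step: "\<And>t. (1 - F s) * F t \<le> (F ((t - s) / sqrt 2))\<^sup>2"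
  shows "\<exists>\<alpha>>0. \<exists>C>0. \<forall>v\<ge>0. F v \<le> C * exp (- \<alpha> * v\<^sup>2)"
proof -
  \<comment> \<open>\<open>r\<close> solves \<open>r + s = sqrt 2 * r\<close>. Shifting levels by
    this fixed point removes \<open>s\<close> from the recursion, and dividing by \<open>p\<close>
    removes the prefactor, leaving the clean inequality \<open>half\<close>.\<close>
  define p r where "p = 1 - F s" and "r = s * (sqrt 2 + 1)"
  define G where "G v = F (v - r) / p" for v
  have p: "3/4 \<le> p" "p \<le> 1" using s F by (auto simp: p_def)
  have G0: "0 \<le> G v" for v using F p by (simp add: G_def)
  have mono: "G v' \<le> G v" if "v \<le> v'" for v v'
    using antimonoD[OF F(1), of "v - r" "v' - r"] that p by (simp add: G_def divide_right_mono)
  have half: "G v \<le> (G (v / sqrt 2))\<^sup>2" for v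
  proof -
    have "(v - r - s) / sqrt 2 = v / sqrt 2 - r"
      by (simp add: r_def field_simps)
    then have "p * F (v - r) \<le> (F (v / sqrt 2 - r))\<^sup>2"
      using step[of "v - r"] by (simp add: p_def)
    then have "p * F (v - r) / p\<^sup>2 \<le> (F (v / sqrt 2 - r))\<^sup>2 / p\<^sup>2"
      by (rule divide_right_mono) simp
    then show ?thesis using p by (simp add: G_def power_divide power2_eq_square)
  qed
  \<comment> \<open>Two rounds at once replace powers of \<open>sqrt 2\<close> by powers of
    2.\<close>
  have quarter: "G v \<le> G (v / 2) ^ 4" for v
  proof -
    have "G v \<le> (G (v / sqrt 2))\<^sup>2" by (rule half)
    also have "\<dots> \<le> ((G (v / sqrt 2 / sqrt 2))\<^sup>2)\<^sup>2"
      using half[of "v / sqrt 2"] G0 by (intro power_mono) auto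
    also have "\<dots> = G (v / 2) ^ 4" by simp
    finally show ?thesis .
  qed
  \<comment> \<open>At this level \<open>G v0 = F s / p\<close>, which is at most
    \<open>(1/4) / (3/4)\<close>: a base below 1 for the iteration.\<close>
  define v0 where "v0 = r + s"
  have v0: "v0 > 0" "r \<ge> 0" using s by (auto simp: v0_def r_def intro!: add_nonneg_pos)
  have Gv0: "G v0 \<le> 1/3" using s(2) p by (simp add: G_def v0_def field_simps)
  have iter: "G (2 ^ n * v0) \<le> (1/3) ^ (4 ^ n)" for n
  proof (induction n)
    case (Suc n)
    have "G (2 ^ Suc n * v0) \<le> G (2 ^ n * v0) ^ 4" using quarter[of "2 ^ Suc n * v0"] by simp
    also have "\<dots> \<le> ((1/3) ^ (4 ^ n)) ^ 4" using Suc G0 by (intro power_mono) auto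
    also have "\<dots> = (1/3) ^ (4 ^ Suc n)" by (simp only: power_mult[symmetric] power_Suc mult.commute)
    finally show ?case .
  qed (use Gv0 in simp)
  \<comment> \<open>The factor 2 in the denominator pays for rounding \<open>v / v0\<close> down to
    a power of 2.\<close>
  define \<alpha> where "\<alpha> = ln 3 / (2 * v0)\<^sup>2"
  have \<alpha>: "\<alpha> > 0" using v0 by (simp add: \<alpha>_def)
  have tail: "F v \<le> exp (- \<alpha> * v\<^sup>2)" if v: "v \<ge> v0" for v
  proof -
    have "nat \<lfloor>v / v0\<rfloor> \<ge> 1" using v v0 by (simp add: le_nat_iff le_floor_iff)
    then obtain n where n: "2 ^ n \<le> nat \<lfloor>v / v0\<rfloor>" "nat \<lfloor>v / v0\<rfloor> < 2 ^ (n + 1)"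
      using ex_power_ivl1[of 2 "nat \<lfloor>v / v0\<rfloor>"] by auto
    have "2 ^ n \<le> real (nat \<lfloor>v / v0\<rfloor>)" using n(1) by (metis of_nat_le_iff of_nat_numeral of_nat_power)
    also have "\<dots> \<le> v / v0" using v v0 by simp
    finally have le: "2 ^ n \<le> v / v0" .
    have "v / v0 \<le> real (nat \<lfloor>v / v0\<rfloor>) + 1" using v v0 by linarith
    also have "\<dots> = real (Suc (nat \<lfloor>v / v0\<rfloor>))" by simp
    also have "\<dots> \<le> real (2 ^ (n + 1))"
      using n(2) by (simp only: of_nat_le_iff Suc_le_eq)
    also have "\<dots> = 2 ^ (n + 1)" by simp
    finally have ge: "v / (2 * v0) \<le> 2 ^ n" using v0 by (simp add: field_simps)
    have "F v \<le> F (v - r)" using antimonoD[OF F(1)] v0 by simp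
    also have "\<dots> \<le> G v" using F p unfolding G_def by (simp add: le_divide_eq mult_left_le)
    also have "\<dots> \<le> G (2 ^ n * v0)" using le v0 by (intro mono) (simp add: field_simps)
    also have "\<dots> \<le> (1/3) ^ (4 ^ n)" by (rule iter)
    also have "\<dots> = exp (- ln 3 * (2 ^ n)\<^sup>2)"
    proof -
      have "(1/3 :: real) = exp (- ln 3)" by (simp add: exp_minus)
      then have "(1/3 :: real) ^ (4 ^ n) = exp (real (4 ^ n) * (- ln 3))"
        by (simp only: exp_of_nat_mult)
      moreover have "real (4 ^ n) = (2 ^ n)\<^sup>2"
        by (simp add: power2_eq_square flip: power_mult_distrib)
      ultimately show ?thesis by (simp only: mult.commute)
    qed
    also have "\<dots> \<le> exp (- ln 3 * (v / (2 * v0))\<^sup>2)"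
      using ge v v0 by (simp add: power_mono)
    also have "\<dots> = exp (- \<alpha> * v\<^sup>2)" by (simp add: \<alpha>_def power_divide)
    finally show ?thesis .
  qed
  \<comment> \<open>The constant makes the bound at least 1 below \<open>v0\<close>, where only
    \<open>F v \<le> 1\<close> is known.\<close>
  have "F v \<le> exp (\<alpha> * v0\<^sup>2) * exp (- \<alpha> * v\<^sup>2)" if "v \<ge> 0" for v
  proof (cases "v \<ge> v0")
    case True
    have "1 * exp (- \<alpha> * v\<^sup>2) \<le> exp (\<alpha> * v0\<^sup>2) * exp (- \<alpha> * v\<^sup>2)"
      using \<alpha> by (intro mult_right_mono) auto
    then show ?thesis using tail[OF True] by linarith
  next
    case False
    have "1 \<le> exp (\<alpha> * v0\<^sup>2) * exp (- \<alpha> * v\<^sup>2)"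
      using False that \<alpha> by (simp add: exp_add[symmetric] power_mono)
    then show ?thesis using F(3)[of v] by simp
  qed
  with \<alpha> show ?thesis by (intro exI[of _ \<alpha>] conjI exI[of _ "exp (\<alpha> * v0\<^sup>2)"]) auto
qed

lemma (in prob_space) prob_Times:
  "A \<in> events \<Longrightarrow> B \<in> events \<Longrightarrow> measure (M \<Otimes>\<^sub>M M) (A \<times> B) = prob A * prob B"
  by (simp add: measure_def emeasure_pair_measure_Times enn2real_mult)

context gaussian_element
begin

text \<open>For independent copies \<open>x\<close>, \<open>y\<close> the pair
  \<open>(x - y) / sqrt 2\<close>, \<open>(x + y) / sqrt 2\<close> has the same joint law as
  \<open>x\<close>, \<open>y\<close>. If the difference is small and the sum large, the triangle
  inequality forces both \<open>x\<close> and \<open>y\<close> to be large, and independence turns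
  this into a square.\<close>

lemma norm_tail_step:
  "prob {\<omega> \<in> space P. norm (X \<omega>) \<le> s} * prob {\<omega> \<in> space P. norm (X \<omega>) > t}
     \<le> (prob {\<omega> \<in> space P. norm (X \<omega>) > (t - s) / sqrt 2})\<^sup>2"
proof -
  interpret PP: pair_prob_space P P ..
  obtain D :: "'k set" where D: "countable D" "closure D = UNIV"
    by (rule compact_UNIV_countable_dense[OF compact_K])
  note nle = norm_bcontfun_le_iff_dense[OF D(2)]
  \<comment> \<open>Two processes are coded as one, indexed by \<open>'k \<times> bool\<close>;
    \<open>False\<close> marks the component required to be small. In the rotated pair this
    component is the difference and \<open>True\<close> is the sum.\<close>
  define E where "E = {v :: 'k \<times> bool \<Rightarrow> real. (\<forall>t\<in>D. \<bar>v (t, False)\<bar> \<le> s) \<and> \<not> (\<forall>u\<in>D. \<bar>v (u, True)\<bar> \<le> t)}"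
  have "E = {v \<in> space (PiM UNIV (\<lambda>_. borel)). (\<forall>t\<in>D. \<bar>v (t, False)\<bar> \<le> s) \<and> \<not> (\<forall>u\<in>D. \<bar>v (u, True)\<bar> \<le> t)}"
    by (simp add: E_def space_PiM)
  also have "\<dots> \<in> sets (PiM UNIV (\<lambda>_. borel))" using D(1) by measurable
  finally have E: "E \<in> sets (PiM UNIV (\<lambda>_. borel))" .
  define A B where "A i = (\<lambda>\<omega>. if snd i then 0 else apply_bcontfun (X \<omega>) (fst i))"
    and "B i = (\<lambda>\<omega>. if snd i then apply_bcontfun (X \<omega>) (fst i) else 0)" for i :: "'k \<times> bool"
  define A' B' where "A' i = (\<lambda>\<omega>. (1 / sqrt 2) * apply_bcontfun (X \<omega>) (fst i))"
    and "B' i = (\<lambda>\<omega>. (if snd i then 1 / sqrt 2 else - 1 / sqrt 2) * apply_bcontfun (X \<omega>) (fst i))" for i :: "'k \<times> bool"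
  have L: "A i \<in> lincomb" "B i \<in> lincomb" "A' i \<in> lincomb" "B' i \<in> lincomb" for i
    unfolding A'_def B'_def
    by (cases "snd i"; simp only: A_def B_def if_True if_False lincomb_zero lincomb_eval)+
      (intro lincomb_scale lincomb_eval)+
  note [measurable] = L[THEN lincomb_law(1)]
  have m: "(\<lambda>\<omega> i. A i (fst \<omega>) + B i (snd \<omega>)) \<in> measurable (P \<Otimes>\<^sub>M P) (PiM UNIV (\<lambda>_. borel))"
    "(\<lambda>\<omega> i. A' i (fst \<omega>) + B' i (snd \<omega>)) \<in> measurable (P \<Otimes>\<^sub>M P) (PiM UNIV (\<lambda>_. borel))"
    by (auto intro!: measurable_PiM_single')
  have "distr (P \<Otimes>\<^sub>M P) (PiM UNIV (\<lambda>_. borel)) (\<lambda>\<omega> i. A i (fst \<omega>) + B i (snd \<omega>)) =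
     distr (P \<Otimes>\<^sub>M P) (PiM UNIV (\<lambda>_. borel)) (\<lambda>\<omega> i. A' i (fst \<omega>) + B' i (snd \<omega>))"
  proof (rule pair_law_eqI[OF L])
    fix i j :: "'k \<times> bool"
    have AA: "expectation (\<lambda>\<omega>. A' i \<omega> * A' j \<omega>) = expectation (\<lambda>\<omega>. apply_bcontfun (X \<omega>) (fst i) * apply_bcontfun (X \<omega>) (fst j)) / 2"
      unfolding A'_def by (simp flip: integral_divide_zero)
    have BB: "expectation (\<lambda>\<omega>. B' i \<omega> * B' j \<omega>) = (if snd i = snd j then 1 else -1) * expectation (\<lambda>\<omega>. apply_bcontfun (X \<omega>) (fst i) * apply_bcontfun (X \<omega>) (fst j)) / 2"
      unfolding B'_def by auto
    show "expectation (\<lambda>\<omega>. A i \<omega> * A j \<omega>) + expectation (\<lambda>\<omega>. B i \<omega> * B j \<omega>) =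
       expectation (\<lambda>\<omega>. A' i \<omega> * A' j \<omega>) + expectation (\<lambda>\<omega>. B' i \<omega> * B' j \<omega>)"
      unfolding AA BB by (auto simp: A_def B_def)
  qed
  from arg_cong[OF this, of "\<lambda>M. measure M E"]
  have eq: "PP.P.prob ((\<lambda>\<omega> i. A i (fst \<omega>) + B i (snd \<omega>)) -` E \<inter> space (P \<Otimes>\<^sub>M P))
    = PP.P.prob ((\<lambda>\<omega> i. A' i (fst \<omega>) + B' i (snd \<omega>)) -` E \<inter> space (P \<Otimes>\<^sub>M P))"
    using m E by (simp add: measure_distr)
  have "prob {\<omega> \<in> space P. norm (X \<omega>) \<le> s} * prob {\<omega> \<in> space P. norm (X \<omega>) > t} 
    = PP.P.prob ({\<omega> \<in> space P. norm (X \<omega>) \<le> s} \<times> {\<omega> \<in> space P. norm (X \<omega>) > t})"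
    by (subst prob_Times) auto
  also have "{\<omega> \<in> space P. norm (X \<omega>) \<le> s} \<times> {\<omega> \<in> space P. norm (X \<omega>) > t} 
    = (\<lambda>\<omega> i. A i (fst \<omega>) + B i (snd \<omega>)) -` E \<inter> space (P \<Otimes>\<^sub>M P)"
    by (auto simp: E_def A_def B_def space_pair_measure nle not_le[symmetric])
  also have "PP.P.prob \<dots> = PP.P.prob ((\<lambda>\<omega> i. A' i (fst \<omega>) + B' i (snd \<omega>)) -` E \<inter> space (P \<Otimes>\<^sub>M P))"
    by (rule eq)
  also have "\<dots> \<le> PP.P.prob ({\<omega> \<in> space P. norm (X \<omega>) > (t - s) / sqrt 2} \<times> {\<omega> \<in> space P. norm (X \<omega>) > (t - s) / sqrt 2})"
  proof (rule PP.P.finite_measure_mono)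
    show "(\<lambda>\<omega> i. A' i (fst \<omega>) + B' i (snd \<omega>)) -` E \<inter> space (P \<Otimes>\<^sub>M P) \<subseteq> {\<omega> \<in> space P. norm (X \<omega>) > (t - s) / sqrt 2} \<times> {\<omega> \<in> space P. norm (X \<omega>) > (t - s) / sqrt 2}"
    proof
      fix w assume w: "w \<in> (\<lambda>\<omega> i. A' i (fst \<omega>) + B' i (snd \<omega>)) -` E \<inter> space (P \<Otimes>\<^sub>M P)"
      define x y where "x = X (fst w)" and "y = X (snd w)"
      have 1: "\<forall>t\<in>D. \<bar>(1 / sqrt 2) * apply_bcontfun x t + (- 1 / sqrt 2) * apply_bcontfun y t\<bar> \<le> s"
        and 2: "\<not> (\<forall>u\<in>D. \<bar>(1 / sqrt 2) * apply_bcontfun x u + (1 / sqrt 2) * apply_bcontfun y u\<bar> \<le> t)"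
        using w by (auto simp: E_def A'_def B'_def x_def y_def)
      have "norm ((1 / sqrt 2) *\<^sub>R x + (- 1 / sqrt 2) *\<^sub>R y) \<le> s"
        unfolding nle using 1 by simp
      moreover have "\<not> norm ((1 / sqrt 2) *\<^sub>R x + (1 / sqrt 2) *\<^sub>R y) \<le> t"
        unfolding nle using 2 by simp
      moreover have "(1 / sqrt 2) *\<^sub>R x + (- 1 / sqrt 2) *\<^sub>R y = (1 / sqrt 2) *\<^sub>R (x - y)"
        "(1 / sqrt 2) *\<^sub>R x + (1 / sqrt 2) *\<^sub>R y = (1 / sqrt 2) *\<^sub>R (x + y)"
        by (simp_all add: scaleR_diff_right scaleR_add_right)
      ultimately have *: "norm (x - y) \<le> s * sqrt 2" "norm (x + y) > t * sqrt 2"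
        by (simp_all add: pos_divide_le_eq pos_less_divide_eq not_le)
      have "norm (x + y) \<le> norm (x - y) + 2 * norm y" "norm (x + y) \<le> norm (x - y) + 2 * norm x"
        using norm_triangle_ineq[of "x - y" "y + y"] norm_triangle_ineq4[of "x + x" "x - y"]
          norm_triangle_ineq[of y y] norm_triangle_ineq[of x x]
        by simp_all
      with * have "(t - s) * sqrt 2 < 2 * norm y" "(t - s) * sqrt 2 < 2 * norm x"
        by (simp_all add: algebra_simps)
      moreover have "(t - s) / sqrt 2 = (t - s) * sqrt 2 / 2"
        using real_sqrt_mult_self[of 2] by (simp add: field_simps del: real_sqrt_mult_self)
      ultimately have "norm x > (t - s) / sqrt 2" "norm y > (t - s) / sqrt 2" by linarith+
      then show "w \<in> {\<omega> \<in> space P. norm (X \<omega>) > (t - s) / sqrt 2} \<times> {\<omega> \<in> space P. norm (X \<omega>) > (t - s) / sqrt 2}"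
        using w by (auto simp: x_def y_def space_pair_measure mem_Times_iff)
    qed
  qed simp
  also have "\<dots> = (prob {\<omega> \<in> space P. norm (X \<omega>) > (t - s) / sqrt 2})\<^sup>2"
    by (subst prob_Times) (auto simp: power2_eq_square)
  finally show ?thesis .
qed

lemma norm_large_exists:
  assumes "e > 0"
  obtains s where "s > 0" "prob {\<omega> \<in> space P. norm (X \<omega>) > s} < e"
proof -
  have "(\<lambda>n. prob {\<omega> \<in> space P. norm (X \<omega>) > real n}) \<longlonglongrightarrow> prob (\<Inter>n. {\<omega> \<in> space P. norm (X \<omega>) > real n})"
    by (intro finite_Lim_measure_decseq) (auto simp: decseq_def)
  also have "(\<Inter>n. {\<omega> \<in> space P. norm (X \<omega>) > real n}) = {}"
  proof -
    have "\<exists>n. \<not> norm (X \<omega>) > real n" for \<omega>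
      using real_arch_simple[of "norm (X \<omega>)"] by (auto simp: not_less)
    then show ?thesis by blast
  qed
  finally have "\<forall>\<^sub>F n in sequentially. prob {\<omega> \<in> space P. norm (X \<omega>) > real n} < e"
    using assms by (auto dest!: order_tendstoD(2)[of _ _ _ e])
  then have "\<forall>\<^sub>F n in sequentially. prob {\<omega> \<in> space P. norm (X \<omega>) > real n} < e \<and> n > 0"
    by (intro eventually_conj eventually_gt_at_top)
  then obtain n where "prob {\<omega> \<in> space P. norm (X \<omega>) > real n} < e" "n > 0"
    by (metis (no_types, lifting) eventually_False_sequentially eventually_mono)
  then show thesis by (intro that[of n]) auto
qed

lemma fernique:
  "\<exists>\<alpha>>0. \<exists>C>0. \<forall>v\<ge>0. prob {\<omega> \<in> space P. norm (X \<omega>) > v} \<le> C * exp (- \<alpha> * v\<^sup>2)"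
proof -
  obtain s where s: "s > 0" "prob {\<omega> \<in> space P. norm (X \<omega>) > s} < 1/4"
    using norm_large_exists[of "1/4"] by auto
  have "prob {\<omega> \<in> space P. norm (X \<omega>) \<le> s} = 1 - prob {\<omega> \<in> space P. norm (X \<omega>) > s}"
    by (subst prob_compl[symmetric]) (auto intro!: arg_cong[of _ _ prob])
  then show ?thesis
    using s norm_tail_step[of s]
    by (intro fernique_iteration[of _ s]) (auto simp: antimono_def intro!: finite_measure_mono)
qed

abbreviation cov :: "'k \<Rightarrow> 'k \<Rightarrow> real" where
  "cov \<equiv> covariance_kernel P (\<lambda>\<omega> t. apply_bcontfun (X \<omega>) t)"

text \<open>The variance of a centred Gaussian is \<open>- 2\<close> times the logarithm of its
  characteristic function at 1, and bounded convergence applies to the latter. This takes the place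
  of a dominating function for the squares.\<close>

lemma lincomb_variance_tendsto:
  assumes A: "\<And>n. A n \<in> lincomb" "S \<in> lincomb" and lim: "\<And>\<omega>. (\<lambda>n. A n \<omega>) \<longlonglongrightarrow> S \<omega>"
  shows "(\<lambda>n. expectation (\<lambda>\<omega>. (A n \<omega>)\<^sup>2)) \<longlonglongrightarrow> expectation (\<lambda>\<omega>. (S \<omega>)\<^sup>2)"
proof -
  note [measurable] = A[THEN lincomb_law(1)]
  have "(\<lambda>n. \<integral>\<omega>. iexp (A n \<omega>) \<partial>P) \<longlonglongrightarrow> (\<integral>\<omega>. iexp (S \<omega>) \<partial>P)"
    by (rule integral_dominated_convergence[where w = "\<lambda>_. 1"]) (auto intro!: tendsto_intros lim)
  then have "(\<lambda>n. Re (\<integral>\<omega>. iexp (A n \<omega>) \<partial>P)) \<longlonglongrightarrow> Re (\<integral>\<omega>. iexp (S \<omega>) \<partial>P)"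
    by (rule tendsto_Re)
  then have "(\<lambda>n. exp (- expectation (\<lambda>\<omega>. (A n \<omega>)\<^sup>2) / 2)) \<longlonglongrightarrow> exp (- expectation (\<lambda>\<omega>. (S \<omega>)\<^sup>2) / 2)"
    using A by (simp add: lincomb_moments)
  from tendsto_ln[OF this] have "(\<lambda>n. (- 2) * (- expectation (\<lambda>\<omega>. (A n \<omega>)\<^sup>2) / 2)) \<longlonglongrightarrow> (- 2) * (- expectation (\<lambda>\<omega>. (S \<omega>)\<^sup>2) / 2)"
    by (intro tendsto_mult tendsto_const) simp
  then show ?thesis by simp
qed

lemma continuous_cov: "continuous_on UNIV (\<lambda>z. cov (fst z) (snd z))"
proof -
  \<comment> \<open>Polarisation writes a covariance as a difference of variances, so that the
    preceding lemma applies; continuity of the paths supplies the pointwise limits.\<close>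
  have pol: "cov s t = (expectation (\<lambda>\<omega>. (apply_bcontfun (X \<omega>) s + apply_bcontfun (X \<omega>) t)\<^sup>2) 
    - expectation (\<lambda>\<omega>. (apply_bcontfun (X \<omega>) s + (-1) * apply_bcontfun (X \<omega>) t)\<^sup>2)) / 4" for s t
  proof -
    have "expectation (\<lambda>\<omega>. (apply_bcontfun (X \<omega>) s + apply_bcontfun (X \<omega>) t)\<^sup>2) 
    - expectation (\<lambda>\<omega>. (apply_bcontfun (X \<omega>) s + (-1) * apply_bcontfun (X \<omega>) t)\<^sup>2) =
      expectation (\<lambda>\<omega>. (apply_bcontfun (X \<omega>) s + apply_bcontfun (X \<omega>) t)\<^sup>2 - (apply_bcontfun (X \<omega>) s + (-1) * apply_bcontfun (X \<omega>) t)\<^sup>2)"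
      by (intro Bochner_Integration.integral_diff[symmetric] lincomb_moments lincomb_add lincomb_scale lincomb_eval)
    also have "\<dots> = expectation (\<lambda>\<omega>. 4 * (apply_bcontfun (X \<omega>) s * apply_bcontfun (X \<omega>) t))"
      by (intro Bochner_Integration.integral_cong) (auto simp: power2_eq_square algebra_simps)
    finally show ?thesis by (simp add: covariance_kernel_def)
  qed
  have "(\<lambda>n. cov (fst (z n)) (snd (z n))) \<longlonglongrightarrow> cov (fst a) (snd a)" if z: "z \<longlonglongrightarrow> a" for z a
  proof -
    have ev: "(\<lambda>n. apply_bcontfun x (f (z n))) \<longlonglongrightarrow> apply_bcontfun x (f a)" if "f = fst \<or> f = snd" for x :: "'k \<Rightarrow>\<^sub>C real" and f
    proof -
      have "(\<lambda>n. f (z n)) \<longlonglongrightarrow> f a" using z that by (auto intro: tendsto_fst tendsto_snd)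
      then show ?thesis
        by (rule continuous_on_tendsto_compose[OF continuous_on_apply_bcontfun[of UNIV x]]) auto
    qed
    show ?thesis unfolding pol
      by (intro tendsto_divide tendsto_diff tendsto_const lincomb_variance_tendsto lincomb_add lincomb_scale lincomb_eval
           tendsto_add tendsto_mult ev) auto
  qed
  then show ?thesis
    by (auto simp: continuous_on_sequentially comp_def)
qed

end

section \<open>Almost minimal finitely supported energies\<close>

text \<open>Choosing net points by successive case distinctions, not by least distance, makes Borel
  measurability immediate; the discrete target makes every fibre measurable.\<close>

lemma finite_net_projection:
  fixes F :: "'k::metric_space set"
  assumes "finite F"
  shows "\<exists>\<pi>. \<pi> \<in> measurable borel (count_space UNIV) \<and> (\<forall>t. (\<exists>x\<in>F. dist x t < d) \<longrightarrow> \<pi> t \<in> F \<and> dist (\<pi> t) t < d)"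
  using assms
proof (induction F)
  case empty
  show ?case by (intro exI[of _ "\<lambda>_. undefined"]) auto
next
  case (insert y F)
  then obtain \<pi> where \<pi>: "\<pi> \<in> measurable borel (count_space UNIV)"
    "\<And>t. (\<exists>x\<in>F. dist x t < d) \<Longrightarrow> \<pi> t \<in> F \<and> dist (\<pi> t) t < d" by auto
  have [measurable]: "Measurable.pred borel (\<lambda>t. dist y t < d)"
    using borel_open[OF open_ball[of y d]] by (simp add: pred_def ball_def)
  show ?case
  proof (intro exI[of _ "\<lambda>t. if dist y t < d then y else \<pi> t"] conjI allI impI)
    show "(\<lambda>t. if dist y t < d then y else \<pi> t) \<in> measurable borel (count_space UNIV)"
      using \<pi>(1) by measurable
  qed (use \<pi>(2) in auto)
qed

lemma (in prob_space) abs_integral_le: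
  fixes f :: "'a \<Rightarrow> real"
  assumes "\<And>x. \<bar>f x\<bar> \<le> B"
  shows "\<bar>expectation f\<bar> \<le> B"
proof (cases "integrable M f")
  case True
  have "expectation f \<le> B" "- B \<le> expectation f"
    using True assms by (auto intro!: integral_le_const integral_ge_const AE_I2 simp: abs_le_iff minus_le_iff)
  then show ?thesis by linarith
next
  \<comment> \<open>A non-integrable function has integral 0 by convention, and the bound at any
    single point gives \<open>0 \<le> B\<close>.\<close>
  case False
  have "0 \<le> B" using assms[of undefined] by linarith
  with False show ?thesis by (simp add: not_integrable_integral_eq)
qed

context gaussian_element
begin

lemma cov_bound: obtains B where "B > 0" "\<And>s t. \<bar>cov s t\<bar> \<le> B"
proof -
  have "compact ((\<lambda>z. cov (fst z) (snd z)) ` (UNIV \<times> UNIV))"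
    by (intro compact_continuous_image compact_Times compact_K) (use continuous_cov in simp)
  then have "bounded (range (\<lambda>z. cov (fst z) (snd z)))"
    by (simp add: compact_imp_bounded)
  then obtain B where B: "B > 0" "\<forall>x\<in>range (\<lambda>z. cov (fst z) (snd z)). norm x \<le> B"
    unfolding bounded_pos by blast
  have "\<bar>cov s t\<bar> \<le> B" for s t
    using B(2)[rule_format, OF rangeI, of "(s, t)"] by simp
  with B(1) show thesis by (rule that)
qed

lemma cov_sym: "cov s t = cov t s"
  by (simp add: covariance_kernel_def mult.commute)

lemma continuous_cov1: "continuous_on UNIV (\<lambda>s. cov s t)"
proof -
  have "continuous_on UNIV (\<lambda>s. (s, t))" by (intro continuous_intros)
  from continuous_on_compose2[OF continuous_cov this] show ?thesis by simp
qed

lemma cov_integrable: 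
  assumes "prob_space \<mu>" "sets \<mu> = sets borel"
  shows "integrable \<mu> (\<lambda>s. cov s t)"
proof -
  interpret \<mu>: prob_space \<mu> by fact
  obtain B where B: "\<And>s t. \<bar>cov s t\<bar> \<le> B" by (rule cov_bound) auto
  have "(\<lambda>s. cov s t) \<in> borel_measurable borel"
    by (rule borel_measurable_continuous_onI[OF continuous_cov1])
  then have "(\<lambda>s. cov s t) \<in> borel_measurable \<mu>"
    using assms(2) by (simp cong: measurable_cong_sets)
  then show ?thesis
    by (intro \<mu>.integrable_const_bound[of _ B]) (use B in auto)
qed

lemma cov_uniform:
  assumes "e > 0"
  obtains d where "d > 0" "\<And>s t s' t'. dist s' s < d \<Longrightarrow> dist t' t < d \<Longrightarrow> \<bar>cov s' t' - cov s t\<bar> < e"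
proof -
  have "uniformly_continuous_on (UNIV \<times> UNIV) (\<lambda>z. cov (fst z) (snd z))"
    by (intro compact_uniformly_continuous compact_Times compact_K) (use continuous_cov in simp)
  then obtain d where d: "d > 0" "\<And>z z'. dist z' z < d \<Longrightarrow> dist (cov (fst z') (snd z')) (cov (fst z) (snd z)) < e"
    unfolding uniformly_continuous_on_def using assms by (auto dest!: spec[of _ e])
  show thesis
  proof (rule that[of "d / 2"])
    fix s t s' t' :: 'k assume "dist s' s < d / 2" "dist t' t < d / 2"
    then have "dist (s', t') (s, t) < d"
      unfolding dist_Pair_Pair using sqrt_sum_squares_le_sum[of "dist s' s" "dist t' t"] by simp
    from d(2)[OF this] show "\<bar>cov s' t' - cov s t\<bar> < e" by (simp add: dist_real_def)
  qed (use d in simp)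
qed

text \<open>Ensures that the inner integral of the energy is a Borel function of \<open>t\<close>,
  so that the outer integral can be split and compared.\<close>

lemma cov_integral_cont:
  assumes "prob_space \<mu>" "sets \<mu> = sets borel"
  shows "continuous_on UNIV (\<lambda>t. \<integral>s. cov s t \<partial>\<mu>)"
proof -
  interpret \<mu>: prob_space \<mu> by fact
  show ?thesis
    unfolding continuous_on_iff
  proof (intro ballI allI impI)
    fix t :: 'k and e :: real assume "e > 0"
    then obtain d where d: "d > 0" "\<And>s t s' t'. dist s' s < d \<Longrightarrow> dist t' t < d \<Longrightarrow> \<bar>cov s' t' - cov s t\<bar> < e / 2"
      using cov_uniform[of "e / 2"] by auto
    show "\<exists>d>0. \<forall>t'\<in>UNIV. dist t' t < d \<longrightarrow> dist (\<integral>s. cov s t' \<partial>\<mu>) (\<integral>s. cov s t \<partial>\<mu>) < e"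
    proof (intro exI[of _ d] conjI ballI impI d(1))
      fix t' assume "dist t' t < d"
      then have "\<bar>cov s t' - cov s t\<bar> \<le> e / 2" for s using d(2)[of s s t' t] d(1) by simp
      then have "\<bar>\<integral>s. cov s t' - cov s t \<partial>\<mu>\<bar> \<le> e / 2" by (rule \<mu>.abs_integral_le)
      then show "dist (\<integral>s. cov s t' \<partial>\<mu>) (\<integral>s. cov s t \<partial>\<mu>) < e"
        using \<open>e > 0\<close> by (simp add: dist_real_def cov_integrable assms)
    qed
  qed
qed

text \<open>A finitely supported probability measure is represented by the random variable to which
  it averages \<open>X\<close>. Its energy is then a second moment, and mixing measures is
  arithmetic with random variables.\<close>

definition convcomb :: "('w \<Rightarrow> real) set" where
  "convcomb = {S. \<exists>T w. finite T \<and> (\<forall>t\<in>T. 0 \<le> w t) \<and> sum w T = 1 \<and> S = (\<lambda>\<omega>. \<Sum>t\<in>T. w t * apply_bcontfun (X \<omega>) t)}"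

lemma convcomb_lincomb: "S \<in> convcomb \<Longrightarrow> S \<in> lincomb"
  by (auto simp: convcomb_def lincomb_def)

lemma convcomb_eval: "(\<lambda>\<omega>. apply_bcontfun (X \<omega>) t) \<in> convcomb"
  unfolding convcomb_def by (auto intro!: exI[of _ "{t}"] exI[of _ "\<lambda>_. 1"])

lemma convcomb_convex:
  assumes "S \<in> convcomb" "S' \<in> convcomb" "0 \<le> l" "l \<le> 1"
  shows "(\<lambda>\<omega>. (1 - l) * S \<omega> + l * S' \<omega>) \<in> convcomb"
proof -
  obtain T c where S: "finite T" "\<And>t. t \<in> T \<Longrightarrow> 0 \<le> c t" "sum c T = 1" "S = (\<lambda>\<omega>. \<Sum>t\<in>T. c t * apply_bcontfun (X \<omega>) t)"
    using assms(1) by (auto simp: convcomb_def)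
  obtain T' c' where S': "finite T'" "\<And>t. t \<in> T' \<Longrightarrow> 0 \<le> c' t" "sum c' T' = 1" "S' = (\<lambda>\<omega>. \<Sum>t\<in>T'. c' t * apply_bcontfun (X \<omega>) t)"
    using assms(2) by (auto simp: convcomb_def)
  define w where "w t = (1 - l) * (if t \<in> T then c t else 0) + l * (if t \<in> T' then c' t else 0)" for t
  have "(\<Sum>t\<in>T. c t * f t) = (\<Sum>t\<in>T \<union> T'. (if t \<in> T then c t else 0) * f t)"
    "(\<Sum>t\<in>T'. c' t * f t) = (\<Sum>t\<in>T \<union> T'. (if t \<in> T' then c' t else 0) * f t)" for f :: "'k \<Rightarrow> real"
    using S S' by (auto intro!: sum.mono_neutral_cong_left)
  then have e: "(1 - l) * (\<Sum>t\<in>T. c t * f t) + l * (\<Sum>t\<in>T'. c' t * f t) = (\<Sum>t\<in>T \<union> T'. w t * f t)" for f :: "'k \<Rightarrow> real"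
    by (simp only: w_def sum.distrib[symmetric] distrib_right sum_distrib_left mult.assoc)
  have "sum w (T \<union> T') = 1" using e[of "\<lambda>_. 1"] S(3) S'(3) by simp
  moreover have "\<forall>t\<in>T \<union> T'. 0 \<le> w t" using S(2) S'(2) assms by (auto simp: w_def)
  ultimately show ?thesis
    unfolding convcomb_def S(4) S'(4) e using S(1) S'(1) by (intro CollectI exI[of _ "T \<union> T'"] exI[of _ w]) auto
qed

lemma convcomb_energy:
  assumes "finite T"
  shows "expectation (\<lambda>\<omega>. (\<Sum>t\<in>T. w t * apply_bcontfun (X \<omega>) t)\<^sup>2) = (\<Sum>s\<in>T. \<Sum>t\<in>T. w s * w t * cov s t)"
  by (simp add: expectation_sum_square[of T "\<lambda>t \<omega>. apply_bcontfun (X \<omega>) t"] lincomb_eval covariance_kernel_def)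

text \<open>An infimum of reals is a lower bound only if the set is bounded below, which the uniform
  bound on the kernel provides.\<close>

lemma min_energy_le:
  assumes "\<mu> \<in> borel_prob_measures"
  shows "min_energy cov \<le> energy cov \<mu>"
proof -
  obtain B where B: "\<And>s t. \<bar>cov s t\<bar> \<le> B" by (rule cov_bound) auto
  have "- B \<le> energy cov \<nu>" if "\<nu> \<in> borel_prob_measures" for \<nu>
  proof -
    interpret \<nu>: prob_space \<nu> using that by (simp add: borel_prob_measures_def)
    have "\<bar>energy cov \<nu>\<bar> \<le> B"
      unfolding energy_def by (intro \<nu>.abs_integral_le B)
    then show ?thesis by linarith
  qed
  then show ?thesis
    unfolding min_energy_def using assms by (intro cINF_lower bdd_belowI2)
qed

lemma min_energy_le_convcomb:
  assumes "S \<in> convcomb"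
  shows "min_energy cov \<le> expectation (\<lambda>\<omega>. (S \<omega>)\<^sup>2)"
proof -
  obtain T w where S: "finite T" "\<And>t. t \<in> T \<Longrightarrow> 0 \<le> w t" "sum w T = 1" "S = (\<lambda>\<omega>. \<Sum>t\<in>T. w t * apply_bcontfun (X \<omega>) t)"
    using assms by (auto simp: convcomb_def)
  \<comment> \<open>The point measure lives on the power set of \<open>T\<close>; the image under
    the identity is a measure on the Borel sets of \<open>'k\<close>.\<close>
  define \<mu> where "\<mu> = distr (point_measure T (\<lambda>t. ennreal (w t))) borel (\<lambda>t. t)"
  have id: "(\<lambda>t. t) \<in> measurable (point_measure T (\<lambda>t. ennreal (w t))) (borel :: 'k measure)"
    by (simp add: measurable_def)
  have "emeasure (point_measure T (\<lambda>t. ennreal (w t))) T = 1"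
    using S by (simp add: emeasure_point_measure_finite sum_ennreal)
  then interpret p: prob_space "point_measure T (\<lambda>t. ennreal (w t))"
    by (intro prob_spaceI) (simp add: space_point_measure)
  have \<mu>: "\<mu> \<in> borel_prob_measures"
    unfolding borel_prob_measures_def \<mu>_def using p.prob_space_distr[OF id] by simp
  have int: "(\<integral>x. f x \<partial>\<mu>) = (\<Sum>t\<in>T. w t * f t)" if "f \<in> borel_measurable borel" for f :: "'k \<Rightarrow> real"
    unfolding \<mu>_def using S that
    by (subst integral_distr[OF id]) (auto simp: lebesgue_integral_point_measure_finite)
  have "energy cov \<mu> = (\<integral>t. (\<Sum>s\<in>T. w s * cov s t) \<partial>\<mu>)"
    unfolding energy_def using int borel_measurable_continuous_onI[OF continuous_cov1] by simp
  also have "\<dots> = (\<Sum>t\<in>T. w t * (\<Sum>s\<in>T. w s * cov s t))"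
  proof (rule int)
    have "(\<lambda>t. cov s t) \<in> borel_measurable borel" for s
      using borel_measurable_continuous_onI[OF continuous_cov1[of s]] by (simp add: cov_sym[of s])
    then show "(\<lambda>t. \<Sum>s\<in>T. w s * cov s t) \<in> borel_measurable borel" by measurable
  qed
  also have "\<dots> = (\<Sum>s\<in>T. \<Sum>t\<in>T. w s * w t * cov s t)"
    by (simp add: sum_distrib_left ac_simps cov_sym)
  also have "\<dots> = expectation (\<lambda>\<omega>. (S \<omega>)\<^sup>2)"
    unfolding S using S(1) by (rule convcomb_energy[symmetric])
  finally show ?thesis using min_energy_le[OF \<mu>] by simp
qed

text \<open>A nearly minimal measure is pushed onto a finite net. Half of \<open>e\<close> pays for
  the near minimality, the other half for moving both arguments of the uniformly continuous kernel
  by less than \<open>d\<close>.\<close>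

lemma convcomb_near_min_energy:
  assumes "e > 0"
  obtains S where "S \<in> convcomb" "expectation (\<lambda>\<omega>. (S \<omega>)\<^sup>2) < min_energy cov + e"
proof -
  \<comment> \<open>Extracting a near minimiser from a real infimum needs a nonempty set.\<close>
  have "(return borel (undefined::'k)) \<in> borel_prob_measures"
    by (auto simp: borel_prob_measures_def intro: prob_space_return)
  then have "(INF \<mu>\<in>borel_prob_measures. energy cov \<mu>) < min_energy cov + e / 2 \<Longrightarrow> \<exists>\<mu>\<in>borel_prob_measures. energy cov \<mu> < min_energy cov + e / 2"
    using cInf_lessD[of "energy cov ` borel_prob_measures"] by auto
  then obtain \<mu> where "\<mu> \<in> borel_prob_measures" and \<mu>e: "energy cov \<mu> < min_energy cov + e / 2"
    using assms by (auto simp: min_energy_def)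
  then have \<mu>: "prob_space \<mu>" and s[measurable_cong]: "sets \<mu> = sets borel" by (auto simp: borel_prob_measures_def)
  interpret \<mu>: prob_space \<mu> by fact
  obtain B where B: "\<And>s t. \<bar>cov s t\<bar> \<le> B" by (rule cov_bound) auto
  obtain d where d: "d > 0" "\<And>s t s' t'. dist s' s < d \<Longrightarrow> dist t' t < d \<Longrightarrow> \<bar>cov s' t' - cov s t\<bar> < e / 2"
    using cov_uniform[of "e / 2"] assms by auto
  have "\<exists>k. finite k \<and> (UNIV :: 'k set) \<subseteq> (\<Union>x\<in>k. ball x d)"
    using compact_K d(1) by (simp add: compact_eq_totally_bounded)
  then obtain F :: "'k set" where F: "finite F" "UNIV \<subseteq> (\<Union>x\<in>F. ball x d)" by blast
  then have "\<exists>x\<in>F. dist x t < d" for t by (auto simp: ball_def)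
  then obtain \<pi> where \<pi>[measurable]: "\<pi> \<in> measurable borel (count_space UNIV)" and \<pi>F: "\<And>t. \<pi> t \<in> F" "\<And>t. dist (\<pi> t) t < d"
    using finite_net_projection[OF F(1), of d] by auto
  have [measurable]: "Measurable.pred \<mu> (\<lambda>t. \<pi> t = x)" for x
    by measurable
  define w where "w x = \<mu>.prob {t \<in> space \<mu>. \<pi> t = x}" for x
  have int: "integrable \<mu> (\<lambda>t. f (\<pi> t))" "(\<integral>t. f (\<pi> t) \<partial>\<mu>) = (\<Sum>x\<in>F. w x * f x)" for f :: "'k \<Rightarrow> real"
  proof -
    have eq: "f (\<pi> t) = (\<Sum>x\<in>F. indicator {t \<in> space \<mu>. \<pi> t = x} t * f x)" if "t \<in> space \<mu>" for t
      using \<pi>F(1)[of t] F(1) that by (simp add: indicator_def if_distrib[of "\<lambda>x. x * _"] cong: if_cong)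
    show "integrable \<mu> (\<lambda>t. f (\<pi> t))"
      by (subst Bochner_Integration.integrable_cong[OF refl eq])
         (auto intro!: Bochner_Integration.integrable_sum integrable_mult_left integrable_real_indicator simp: \<mu>.emeasure_eq_measure)
    show "(\<integral>t. f (\<pi> t) \<partial>\<mu>) = (\<Sum>x\<in>F. w x * f x)"
      by (subst Bochner_Integration.integral_cong[OF refl eq])
         (auto intro!: sum.cong simp: w_def \<mu>.emeasure_eq_measure integrable_real_indicator)
  qed
  have w: "\<And>x. 0 \<le> w x" "sum w F = 1"
    using int(2)[of "\<lambda>_. 1"] by (auto simp: w_def \<mu>.prob_space)
  define S where "S = (\<lambda>\<omega>. \<Sum>t\<in>F. w t * apply_bcontfun (X \<omega>) t)"
  have "S \<in> convcomb" using F(1) w unfolding S_def convcomb_def by auto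
  moreover have "expectation (\<lambda>\<omega>. (S \<omega>)\<^sup>2) < min_energy cov + e"
  proof -
    have "expectation (\<lambda>\<omega>. (S \<omega>)\<^sup>2) = (\<Sum>t\<in>F. w t * (\<Sum>s\<in>F. w s * cov s t))"
      unfolding S_def convcomb_energy[OF F(1)] by (simp add: sum_distrib_left ac_simps cov_sym)
    also have "\<dots> = (\<integral>t. (\<integral>s. cov (\<pi> s) (\<pi> t) \<partial>\<mu>) \<partial>\<mu>)"
      using int(2)[of "\<lambda>x. cov x _"] int(2)[of "\<lambda>x. \<Sum>s\<in>F. w s * cov s x"] by simp
    finally have 1: "expectation (\<lambda>\<omega>. (S \<omega>)\<^sup>2) = (\<integral>t. (\<integral>s. cov (\<pi> s) (\<pi> t) \<partial>\<mu>) \<partial>\<mu>)" .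
    have inner: "\<bar>(\<integral>s. cov (\<pi> s) (\<pi> t) \<partial>\<mu>) - (\<integral>s. cov s t \<partial>\<mu>)\<bar> \<le> e / 2" for t
    proof -
      have "\<bar>\<integral>s. cov (\<pi> s) (\<pi> t) - cov s t \<partial>\<mu>\<bar> \<le> e / 2"
        using \<pi>F(2) d(2) by (intro \<mu>.abs_integral_le less_imp_le) auto
      then show ?thesis using int(1)[of "\<lambda>x. cov x (\<pi> t)"] by (simp add: cov_integrable \<mu> s)
    qed
    have i1: "integrable \<mu> (\<lambda>t. \<integral>s. cov s t \<partial>\<mu>)"
      by (rule \<mu>.integrable_const_bound[of _ B])
         (use \<mu>.abs_integral_le[OF B] borel_measurable_continuous_onI[OF cov_integral_cont[OF \<mu> s]] in \<open>auto\<close>)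
    have i2: "integrable \<mu> (\<lambda>t. \<integral>s. cov (\<pi> s) (\<pi> t) \<partial>\<mu>)"
      using int(1)[of "\<lambda>x. \<integral>s. cov (\<pi> s) x \<partial>\<mu>"] .
    have "\<bar>\<integral>t. (\<integral>s. cov (\<pi> s) (\<pi> t) \<partial>\<mu>) - (\<integral>s. cov s t \<partial>\<mu>) \<partial>\<mu>\<bar> \<le> e / 2"
      by (rule \<mu>.abs_integral_le) (rule inner)
    then have "\<bar>(\<integral>t. (\<integral>s. cov (\<pi> s) (\<pi> t) \<partial>\<mu>) \<partial>\<mu>) - energy cov \<mu>\<bar> \<le> e / 2"
      by (simp only: Bochner_Integration.integral_diff[OF i2 i1] energy_def)
    then show ?thesis using 1 \<mu>e by linarith
  qed
  ultimately show thesis by (rule that)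
qed

text \<open>
  Compactness of the space of probability measures is avoided: an almost minimizing finitely supported
  measure satisfies the optimality condition (potential at least the energy) up to a relative error \<open>\<kappa>\<close>,
  by perturbing it towards a point mass.
\<close>

lemma almost_equilibrium:
  assumes pos: "min_energy cov > 0" and \<kappa>: "\<kappa> > 0"
  obtains Y where "Y \<in> convcomb" "min_energy cov \<le> expectation (\<lambda>\<omega>. (Y \<omega>)\<^sup>2)"
    "expectation (\<lambda>\<omega>. (Y \<omega>)\<^sup>2) \<le> (1 + \<kappa>) * min_energy cov"
    "\<And>t. expectation (\<lambda>\<omega>. Y \<omega> * apply_bcontfun (X \<omega>) t) \<ge> (1 - \<kappa>) * expectation (\<lambda>\<omega>. (Y \<omega>)\<^sup>2)"
proof -
  define \<sigma> where "\<sigma> = min_energy cov"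
  obtain B where B: "B > 0" "\<And>s t. \<bar>cov s t\<bar> \<le> B" by (rule cov_bound) blast
  \<comment> \<open>\<open>l\<close> is the mass moved to the point \<open>t\<close>. The cap
    \<open>1/2\<close> gives \<open>1 \<le> 2 * (1 - l)\<close>; the other bound keeps the
    second-order terms \<open>l\<^sup>2 * (1 + B)\<close> below
    \<open>2 * l * (1 - l) * \<kappa>\<close> times the energy.\<close>
  define l where "l = min (1/2) (\<kappa> * \<sigma> / (1 + B))"
  have "0 < l" using pos \<kappa> B(1) by (simp add: l_def \<sigma>_def)
  moreover have "l \<le> 1/2" "l \<le> \<kappa> * \<sigma> / (1 + B)"
    unfolding l_def by (rule min.cobounded1, rule min.cobounded2)
  ultimately have l: "0 < l" "l \<le> 1/2" "l \<le> \<kappa> * \<sigma> / (1 + B)" .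
  then have lB: "l * (1 + B) \<le> \<kappa> * \<sigma>"
    using B(1) by (simp add: pos_le_divide_eq)
  moreover have "l \<le> l * (1 + B)" using l B(1) by simp
  ultimately have l\<kappa>: "l \<le> \<kappa> * \<sigma>" by linarith
  \<comment> \<open>The allowed excess is quadratic in \<open>l\<close>, so it ranks with the
    second-order terms and does not spoil the first-order comparison.\<close>
  obtain Y where Y: "Y \<in> convcomb" "expectation (\<lambda>\<omega>. (Y \<omega>)\<^sup>2) < \<sigma> + l\<^sup>2"
    using convcomb_near_min_energy[of "l\<^sup>2"] l unfolding \<sigma>_def by auto
  let ?s = "expectation (\<lambda>\<omega>. (Y \<omega>)\<^sup>2)"
  have s: "\<sigma> \<le> ?s" unfolding \<sigma>_def by (rule min_energy_le_convcomb[OF Y(1)])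
  have "l\<^sup>2 \<le> l * 1" unfolding power2_eq_square using l by (intro mult_left_mono) auto
  then have up: "?s \<le> (1 + \<kappa>) * \<sigma>" using Y(2) l\<kappa> by (simp add: algebra_simps)
  have "expectation (\<lambda>\<omega>. Y \<omega> * apply_bcontfun (X \<omega>) t) \<ge> (1 - \<kappa>) * ?s" for t
  proof -
    let ?h = "expectation (\<lambda>\<omega>. Y \<omega> * apply_bcontfun (X \<omega>) t)"
    note YL = convcomb_lincomb[OF Y(1)] and XL = lincomb_eval[of t]
    have "\<sigma> \<le> expectation (\<lambda>\<omega>. ((1 - l) * Y \<omega> + l * apply_bcontfun (X \<omega>) t)\<^sup>2)"
      unfolding \<sigma>_def using l by (intro min_energy_le_convcomb convcomb_convex Y convcomb_eval) auto
    also have "(\<lambda>\<omega>. ((1 - l) * Y \<omega> + l * apply_bcontfun (X \<omega>) t)\<^sup>2) =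
      (\<lambda>\<omega>. (1 - l)\<^sup>2 * (Y \<omega>)\<^sup>2 + 2 * l * (1 - l) * (Y \<omega> * apply_bcontfun (X \<omega>) t) + l\<^sup>2 * (apply_bcontfun (X \<omega>) t)\<^sup>2)"
      by (auto simp: fun_eq_iff power2_eq_square algebra_simps)
    also have "expectation \<dots> = (1 - l)\<^sup>2 * ?s + 2 * l * (1 - l) * ?h + l\<^sup>2 * cov t t"
      using lincomb_moments(2)[OF YL] lincomb_moments(2)[OF XL] lincomb_integrable_mult[OF YL XL]
      by (simp add: covariance_kernel_def power2_eq_square)
    finally have "\<sigma> \<le> (1 - l)\<^sup>2 * ?s + 2 * l * (1 - l) * ?h + l\<^sup>2 * cov t t" .
    moreover have "l\<^sup>2 * cov t t \<le> l\<^sup>2 * B" using B(2)[of t t] by (intro mult_left_mono) auto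
    ultimately have a: "?s - l\<^sup>2 < (1 - l)\<^sup>2 * ?s + 2 * l * (1 - l) * ?h + l\<^sup>2 * B" using Y(2) by linarith
    have "2 * l * (1 - l) * ((1 - \<kappa>) * ?s) \<le> 2 * l * (1 - l) * ?h"
    proof -
      have "l * (1 + B) \<le> \<kappa> * ?s" using lB s \<kappa> by (meson mult_left_mono less_imp_le order_trans)
      moreover have "1 \<le> 2 * (1 - l)" using l by simp
      ultimately have "l * (1 + B) \<le> 2 * (1 - l) * (\<kappa> * ?s)"
        using mult_mono[of 1 "2 * (1 - l)" "l * (1 + B)" "\<kappa> * ?s"] l B by simp
      then have b: "l * (l * (1 + B)) \<le> l * (2 * (1 - l) * (\<kappa> * ?s))" using l by (intro mult_left_mono) auto
      have "0 \<le> l\<^sup>2 * ?s" by simp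
      then show ?thesis using a b by (simp add: power2_eq_square algebra_simps)
    qed
    moreover have "2 * l * (1 - l) > 0" using l by simp
    ultimately show ?thesis by (simp only: mult_le_cancel_left_pos)
  qed
  with Y(1) s up show thesis unfolding \<sigma>_def by (intro that)
qed

end

section \<open>Gaussian tails\<close>

definition gauss_tail :: "real \<Rightarrow> real \<Rightarrow> real" where
  "gauss_tail s \<tau> = (\<integral>y. normal_density 0 s y * indicator {\<tau>..} y \<partial>lborel)"

lemma gauss_tail_integrable:
  "0 < s \<Longrightarrow> integrable lborel (\<lambda>y. normal_density 0 s y * indicator {\<tau>..} y)"
  by (intro integrable_mult_indicator[where 'a = real and 'b = real, simplified mult.commute[of "indicator _ _"] real_scaleR_def]) 
     (auto intro!: integrable_normal_density simp: mult.commute)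

lemma normal_density_shift:
  assumes "0 < s"
  shows "normal_density 0 s (y + \<delta>) = normal_density 0 s y * exp (- (2 * y * \<delta> + \<delta>\<^sup>2) / (2 * s\<^sup>2))"
  using assms
  by (simp add: normal_density_def exp_add[symmetric] add_divide_distrib[symmetric] diff_divide_distrib[symmetric] power2_eq_square algebra_simps)

lemma gauss_tail_shift:
  assumes "0 < s"
  shows "gauss_tail s (\<tau> + \<delta>) = (\<integral>y. normal_density 0 s (y + \<delta>) * indicator {\<tau>..} y \<partial>lborel)"
    "integrable lborel (\<lambda>y. normal_density 0 s (y + \<delta>) * indicator {\<tau>..} y)"
proof -
  have i: "indicator {\<tau> + \<delta>..} (\<delta> + 1 * y) = (indicator {\<tau>..} y :: real)" for y
    by (auto simp: indicator_def)
  show "gauss_tail s (\<tau> + \<delta>) = (\<integral>y. normal_density 0 s (y + \<delta>) * indicator {\<tau>..} y \<partial>lborel)"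
    unfolding gauss_tail_def
    by (subst lborel_integral_real_affine[of 1 _ \<delta>]) (simp_all only: i, simp_all add: add.commute)
  show "integrable lborel (\<lambda>y. normal_density 0 s (y + \<delta>) * indicator {\<tau>..} y)"
    using lborel_integrable_real_affine[OF gauss_tail_integrable[OF assms, of "\<tau> + \<delta>"], of 1 \<delta>]
    by (simp only: i) (simp add: add.commute)
qed

lemma gauss_tail_nonneg: "0 \<le> gauss_tail s \<tau>"
  by (simp add: gauss_tail_def)

lemma gauss_tail_antimono:
  assumes "0 < s" "\<tau> \<le> \<tau>'"
  shows "gauss_tail s \<tau>' \<le> gauss_tail s \<tau>"
  unfolding gauss_tail_def using assms
  by (intro integral_mono gauss_tail_integrable) (auto simp: indicator_def)

lemma gauss_tail_le_1: "0 < s \<Longrightarrow> gauss_tail s \<tau> \<le> 1"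
proof -
  assume s: "0 < s"
  have "gauss_tail s \<tau> \<le> (\<integral>y. normal_density 0 s y \<partial>lborel)"
    unfolding gauss_tail_def using s
    by (intro integral_mono gauss_tail_integrable) (auto simp: indicator_def)
  then show ?thesis using s by simp
qed

text \<open>On the half-line from \<tau>, the ratio of the shifted to the original density is
  largest at the left end.\<close>

lemma gauss_tail_shift_le:
  assumes s: "0 < s" and \<delta>: "0 \<le> \<delta>"
  shows "gauss_tail s (\<tau> + \<delta>) \<le> exp (- (2 * \<tau> * \<delta> + \<delta>\<^sup>2) / (2 * s\<^sup>2)) * gauss_tail s \<tau>"
proof -
  have "normal_density 0 s (y + \<delta>) * indicator {\<tau>..} y \<le> exp (- (2 * \<tau> * \<delta> + \<delta>\<^sup>2) / (2 * s\<^sup>2)) * (normal_density 0 s y * indicator {\<tau>..} y)" for y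
  proof (cases "\<tau> \<le> y")
    case True
    then have "exp (- (2 * y * \<delta> + \<delta>\<^sup>2) / (2 * s\<^sup>2)) \<le> exp (- (2 * \<tau> * \<delta> + \<delta>\<^sup>2) / (2 * s\<^sup>2))"
      using \<delta> s by (auto intro!: divide_right_mono mult_right_mono)
    then have "normal_density 0 s y * exp (- (2 * y * \<delta> + \<delta>\<^sup>2) / (2 * s\<^sup>2)) \<le> normal_density 0 s y * exp (- (2 * \<tau> * \<delta> + \<delta>\<^sup>2) / (2 * s\<^sup>2))"
      by (intro mult_left_mono) auto
    then show ?thesis using True by (simp only: normal_density_shift[OF s]) (simp add: mult.commute)
  qed simp
  then show ?thesis
    unfolding gauss_tail_shift(1)[OF s] gauss_tail_def[of s \<tau>]
    by (subst integral_mult_right_zero[symmetric], intro integral_mono gauss_tail_shift s integrable_mult_right gauss_tail_integrable) 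
qed

text \<open>The density ratio decreases in \<open>y\<close> and has no positive lower bound on the
  half-line, so only the part below \<open>b\<close> is kept, where the value at \<open>b\<close>
  bounds it from below. For \<open>b \<le> \<tau>\<close> the left side is not positive, so the
  cutoff is free.\<close>

lemma gauss_tail_shift_ge:
  assumes s: "0 < s" and \<delta>: "0 \<le> \<delta>"
  shows "gauss_tail s (\<tau> + \<delta>) \<ge> exp (- (2 * b * \<delta> + \<delta>\<^sup>2) / (2 * s\<^sup>2)) * (gauss_tail s \<tau> - gauss_tail s b)"
proof -
  let ?e = "exp (- (2 * b * \<delta> + \<delta>\<^sup>2) / (2 * s\<^sup>2))"
  have *: "?e * (normal_density 0 s y * indicator {\<tau>..} y - normal_density 0 s y * indicator {b..} y) \<le> normal_density 0 s (y + \<delta>) * indicator {\<tau>..} y" for y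
  proof (cases "\<tau> \<le> y \<and> y < b")
    case True
    then have "?e \<le> exp (- (2 * y * \<delta> + \<delta>\<^sup>2) / (2 * s\<^sup>2))"
      using \<delta> s by (auto intro!: divide_right_mono mult_right_mono)
    then have "normal_density 0 s y * ?e \<le> normal_density 0 s y * exp (- (2 * y * \<delta> + \<delta>\<^sup>2) / (2 * s\<^sup>2))"
      by (intro mult_left_mono) auto
    then show ?thesis using True by (simp only: normal_density_shift[OF s]) (simp add: mult.commute)
  qed (auto simp: indicator_def intro!: mult_nonneg_nonneg)
  have "?e * (gauss_tail s \<tau> - gauss_tail s b) = (\<integral>y. ?e * (normal_density 0 s y * indicator {\<tau>..} y - normal_density 0 s y * indicator {b..} y) \<partial>lborel)"
    unfolding gauss_tail_def using gauss_tail_integrable[OF s] by (subst integral_mult_right_zero) (simp add: Bochner_Integration.integral_diff)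
  also have "\<dots> \<le> gauss_tail s (\<tau> + \<delta>)"
    unfolding gauss_tail_shift(1)[OF s]
    by (intro integral_mono * gauss_tail_shift s integrable_mult_right Bochner_Integration.integrable_diff gauss_tail_integrable)
  finally show ?thesis .
qed

lemma gauss_tail_le_exp:
  assumes s: "0 < s" and b: "0 \<le> b"
  shows "gauss_tail s b \<le> exp (- b\<^sup>2 / (2 * s\<^sup>2))"
proof -
  have "gauss_tail s (0 + b) \<le> exp (- (2 * 0 * b + b\<^sup>2) / (2 * s\<^sup>2)) * gauss_tail s 0"
    by (rule gauss_tail_shift_le[OF s b])
  also have "\<dots> \<le> exp (- b\<^sup>2 / (2 * s\<^sup>2)) * 1"
    using gauss_tail_le_1[OF s, of 0] by (intro mult_mono) (auto simp: gauss_tail_nonneg)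
  finally show ?thesis by simp
qed

text \<open>Only the unit interval from \<open>b\<close> is used, with the density at its right end.
  The lost constant and the shift by 1 are harmless against a gap between quadratic
  exponents.\<close>

lemma gauss_tail_ge_exp:
  assumes s: "0 < s" and b: "0 \<le> b"
  shows "exp (- (b + 1)\<^sup>2 / (2 * s\<^sup>2)) / sqrt (2 * pi * s\<^sup>2) \<le> gauss_tail s b"
proof -
  have "normal_density 0 s (b + 1) * indicator {b..b+1} y \<le> normal_density 0 s y * indicator {b..} y" for y
  proof (cases "y \<in> {b..b+1}")
    case True
    then have "y\<^sup>2 \<le> (b + 1)\<^sup>2" using b by (intro power_mono) auto
    then have "normal_density 0 s (b + 1) \<le> normal_density 0 s y"
      unfolding normal_density_def by (intro mult_left_mono) (auto intro!: divide_right_mono)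
    then show ?thesis using True by simp
  qed simp
  then have "(\<integral>y. normal_density 0 s (b + 1) * indicator {b..b+1} y \<partial>lborel) \<le> gauss_tail s b"
    unfolding gauss_tail_def using s
    by (intro integral_mono gauss_tail_integrable) auto
  then show ?thesis by (simp add: normal_density_def)
qed

lemma (in prob_space) gaussian_law_tail:
  assumes [measurable]: "S \<in> borel_measurable M" and D: "distr M borel S = gaussian_law 0 s" and s: "0 < s"
  shows "prob {\<omega> \<in> space M. \<tau> \<le> S \<omega>} = gauss_tail s \<tau>"
proof -
  have "prob {\<omega> \<in> space M. \<tau> \<le> S \<omega>} = (\<integral>y. indicator {\<tau>..} y \<partial>distr M borel S)"
    by (simp add: measure_distr vimage_def Int_def conj_commute)
  also have "\<dots> = gauss_tail s \<tau>"
    unfolding D gaussian_law_def gauss_tail_def using s by (subst if_not_P, simp, subst integral_density) auto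
  finally show ?thesis .
qed

text \<open>Factoring the difference of squares shows that the gap between the slopes
  \<open>a\<close> and \<open>b\<close> outweighs any fixed offset \<open>k\<close>.\<close>

lemma exp_quadratic_gap_tendsto_0:
  fixes a b d k :: real
  assumes "0 < a" "a < b" "0 < d"
  shows "((\<lambda>u. exp (((a * (u + k))\<^sup>2 - (b * u)\<^sup>2) / d)) \<longlongrightarrow> 0) at_top"
proof -
  have lin: "filterlim (\<lambda>u. e + c * u) at_top at_top" if "0 < c" for c e :: real
    using that by (intro filterlim_tendsto_add_at_top[OF tendsto_const] filterlim_tendsto_pos_mult_at_top[OF tendsto_const] filterlim_ident)
  have "filterlim (\<lambda>u. (1 / d) * ((- (a * k) + (b - a) * u) * (a * k + (a + b) * u))) at_top at_top"
    using assms by (intro filterlim_tendsto_pos_mult_at_top[OF tendsto_const] filterlim_at_top_mult_at_top lin) auto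
  then have "filterlim (\<lambda>u. - ((1 / d) * ((- (a * k) + (b - a) * u) * (a * k + (a + b) * u)))) at_bot at_top"
    by (simp only: filterlim_uminus_at_top)
  moreover have "- ((1 / d) * ((- (a * k) + (b - a) * u) * (a * k + (a + b) * u))) = ((a * (u + k))\<^sup>2 - (b * u)\<^sup>2) / d" for u
    using assms(3) by (simp add: power2_eq_square field_simps)
  ultimately show ?thesis
    by (simp only: filterlim_compose[OF exp_at_bot])
qed

section \<open>Regression on an almost minimal average\<close>

lemma (in gaussian_element) convcomb_obtain:
  assumes "Y \<in> convcomb"
  obtains T w where "finite T" "\<And>t. t \<in> T \<Longrightarrow> 0 \<le> w t" "sum w T = 1" "\<And>\<omega>. Y \<omega> = (\<Sum>t\<in>T. w t * apply_bcontfun (X \<omega>) t)"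
  using assms by (auto simp: convcomb_def)

text \<open>The nonstrict inequality matches the closed half-line event
  \<open>thr v \<omega> \<le> Y\<close>; strict exceedances are recovered at the end.\<close>

definition (in gaussian_element) min_tail :: "real \<Rightarrow> real" where
  "min_tail v = prob {\<omega> \<in> space P. \<forall>t. v \<le> apply_bcontfun (X \<omega>) t}"

lemma continuous_ge_iff_dense:
  fixes f :: "'k::metric_space \<Rightarrow> real"
  assumes "closure D = UNIV" "continuous_on UNIV f"
  shows "(\<forall>t. v \<le> f t) \<longleftrightarrow> (\<forall>t\<in>D. v \<le> f t)"
  using continuous_ge_on_closure[of D f] assms by (metis UNIV_I)

lemma (in gaussian_element) path_ge_events: "{\<omega> \<in> space P. \<forall>t. v \<le> apply_bcontfun (X \<omega>) t} \<in> events"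
proof -
  obtain D :: "'k set" where D: "countable D" "closure D = UNIV"
    by (rule compact_UNIV_countable_dense[OF compact_K])
  show ?thesis
    unfolding continuous_ge_iff_dense[OF D(2) continuous_on_apply_bcontfun] using D(1) by measurable
qed

locale gaussian_regression = gaussian_element P X for P :: "'w measure" and X :: "'w \<Rightarrow> 'k::metric_space \<Rightarrow>\<^sub>C real" +
  fixes Y :: "'w \<Rightarrow> real" and \<kappa> :: real
  assumes Y: "Y \<in> convcomb" and var_pos: "0 < expectation (\<lambda>\<omega>. (Y \<omega>)\<^sup>2)"
    and \<kappa>: "0 \<le> \<kappa>" "\<kappa> < 1"
    and cov_Y_ge: "\<And>t. (1 - \<kappa>) * expectation (\<lambda>\<omega>. (Y \<omega>)\<^sup>2) \<le> expectation (\<lambda>\<omega>. Y \<omega> * apply_bcontfun (X \<omega>) t)"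
begin

definition sd :: real where "sd = sqrt (expectation (\<lambda>\<omega>. (Y \<omega>)\<^sup>2))"

text \<open>The regression coefficient of the path value at \<open>t\<close> on \<open>Y\<close>;
  equivalently the potential of the averaging measure at \<open>t\<close> divided by its
  energy.\<close>

definition g :: "'k \<Rightarrow> real" where "g t = expectation (\<lambda>\<omega>. Y \<omega> * apply_bcontfun (X \<omega>) t) / sd\<^sup>2"

definition Z :: "'k \<Rightarrow> 'w \<Rightarrow> real" where "Z t \<omega> = apply_bcontfun (X \<omega>) t + - g t * Y \<omega>"

definition thr :: "real \<Rightarrow> 'w \<Rightarrow> real" where "thr v \<omega> = (SUP t. (v - Z t \<omega>) / g t)"

lemma sd: "0 < sd" "sd\<^sup>2 = expectation (\<lambda>\<omega>. (Y \<omega>)\<^sup>2)"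
  using var_pos by (auto simp: sd_def)

lemma Y_lincomb: "Y \<in> lincomb"
  using Y by (rule convcomb_lincomb)

lemma Y_measurable[measurable]: "Y \<in> borel_measurable P"
  using Y_lincomb by (rule lincomb_law(1))

lemma g_ge: "1 - \<kappa> \<le> g t" and g_pos: "0 < g t"
proof -
  show "1 - \<kappa> \<le> g t" using cov_Y_ge[of t] var_pos by (simp add: g_def sd(2) pos_le_divide_eq)
  with \<kappa> show "0 < g t" by linarith
qed

lemma g_eq:
  assumes "finite T" "\<And>\<omega>. Y \<omega> = (\<Sum>t\<in>T. w t * apply_bcontfun (X \<omega>) t)"
  shows "g t = (\<Sum>s\<in>T. w s * cov s t) / sd\<^sup>2"
proof -
  have "(\<lambda>\<omega>. Y \<omega> * apply_bcontfun (X \<omega>) t) = (\<lambda>\<omega>. \<Sum>s\<in>T. w s * (apply_bcontfun (X \<omega>) s * apply_bcontfun (X \<omega>) t))"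
    by (simp add: assms(2) sum_distrib_right mult.assoc)
  then show ?thesis
    unfolding g_def by (simp add: lincomb_integrable_mult lincomb_eval covariance_kernel_def)
qed

lemma continuous_g: "continuous_on UNIV g"
proof -
  obtain T w where T: "finite T" "\<And>\<omega>. Y \<omega> = (\<Sum>t\<in>T. w t * apply_bcontfun (X \<omega>) t)"
    by (rule convcomb_obtain[OF Y]) auto
  have "g = (\<lambda>t. (\<Sum>s\<in>T. w s * cov t s) / sd\<^sup>2)"
    using g_eq[OF T] by (simp add: fun_eq_iff cov_sym)
  then show ?thesis
    using sd by (auto intro!: continuous_intros continuous_cov1)
qed

text \<open>Only the kernel bound and the variance enter. Once the variance is bounded below by the
  minimum energy, the constant no longer depends on \<kappa>, so \<kappa> can be chosen after
  it.\<close>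

lemma g_le:
  assumes "\<And>s t. \<bar>cov s t\<bar> \<le> B"
  shows "g t \<le> B / sd\<^sup>2"
proof -
  obtain T w where T: "finite T" "\<And>t. t \<in> T \<Longrightarrow> 0 \<le> w t" "sum w T = 1" "\<And>\<omega>. Y \<omega> = (\<Sum>t\<in>T. w t * apply_bcontfun (X \<omega>) t)"
    by (rule convcomb_obtain[OF Y]) blast
  have "(\<Sum>s\<in>T. w s * cov s t) \<le> (\<Sum>s\<in>T. w s * B)"
    using assms T(2) by (intro sum_mono mult_left_mono) (auto intro: order_trans[OF abs_ge_self])
  also have "\<dots> = B" by (simp add: sum_distrib_right[symmetric] T(3))
  finally show ?thesis unfolding g_eq[OF T(1,4)] using sd by (intro divide_right_mono) auto
qed

lemma abs_Y_le: "\<bar>Y \<omega>\<bar> \<le> norm (X \<omega>)"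
proof -
  obtain T w where T: "finite T" "\<And>t. t \<in> T \<Longrightarrow> 0 \<le> w t" "sum w T = 1" "\<And>\<omega>. Y \<omega> = (\<Sum>t\<in>T. w t * apply_bcontfun (X \<omega>) t)"
    by (rule convcomb_obtain[OF Y]) blast
  have "\<bar>Y \<omega>\<bar> \<le> (\<Sum>t\<in>T. \<bar>w t * apply_bcontfun (X \<omega>) t\<bar>)" unfolding T(4) by (rule sum_abs)
  also have "\<dots> \<le> (\<Sum>t\<in>T. w t * norm (X \<omega>))"
    using T(2) norm_bounded[of "X \<omega>"] by (intro sum_mono) (auto simp: abs_mult intro!: mult_mono)
  also have "\<dots> = norm (X \<omega>)" by (simp add: sum_distrib_right[symmetric] T(3))
  finally show ?thesis .
qed

lemma abs_Z_le:
  assumes "\<And>t. g t \<le> C"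
  shows "\<bar>Z t \<omega>\<bar> \<le> (1 + C) * norm (X \<omega>)"
proof -
  have "\<bar>g t * Y \<omega>\<bar> \<le> C * norm (X \<omega>)"
    unfolding abs_mult using assms[of t] g_pos[of t] abs_Y_le[of \<omega>] by (intro mult_mono) auto
  moreover have "\<bar>apply_bcontfun (X \<omega>) t\<bar> \<le> norm (X \<omega>)" using norm_bounded[of "X \<omega>" t] by simp
  ultimately show ?thesis unfolding Z_def by (simp add: algebra_simps)
qed

lemma average_Z: "\<forall>t. v \<le> Z t \<omega> + g t * y \<Longrightarrow> v \<le> y"
proof -
  assume v: "\<forall>t. v \<le> Z t \<omega> + g t * y"
  obtain T w where T: "finite T" "\<And>t. t \<in> T \<Longrightarrow> 0 \<le> w t" "sum w T = 1" "\<And>\<omega>. Y \<omega> = (\<Sum>t\<in>T. w t * apply_bcontfun (X \<omega>) t)"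
    by (rule convcomb_obtain[OF Y]) blast
  \<comment> \<open>Averaging the covariances of \<open>Y\<close> with the path values over the
    weights of \<open>Y\<close> returns the variance of \<open>Y\<close>.\<close>
  have "(\<Sum>t\<in>T. w t * g t) = (\<Sum>t\<in>T. \<Sum>s\<in>T. w t * w s * cov s t) / sd\<^sup>2"
    by (simp add: g_eq[OF T(1,4)] sum_divide_distrib sum_distrib_left ac_simps)
  also have "(\<Sum>t\<in>T. \<Sum>s\<in>T. w t * w s * cov s t) = sd\<^sup>2"
    unfolding sd(2) T(4) convcomb_energy[OF T(1)] by (simp add: cov_sym)
  finally have wg: "(\<Sum>t\<in>T. w t * g t) = 1" using sd(1) by simp
  have "v = (\<Sum>t\<in>T. w t * v)" by (simp add: sum_distrib_right[symmetric] T(3))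
  also have "\<dots> \<le> (\<Sum>t\<in>T. w t * (Z t \<omega> + g t * y))"
    using T(2) v by (intro sum_mono mult_left_mono) auto
  also have "\<dots> = Y \<omega> - (\<Sum>t\<in>T. w t * g t) * Y \<omega> + (\<Sum>t\<in>T. w t * g t) * y"
    by (simp add: Z_def T(4)[of \<omega>] distrib_left right_diff_distrib sum.distrib sum_subtractf sum_distrib_right mult.assoc)
  finally show "v \<le> y" by (simp add: wg)
qed

lemma thr_le_iff: "thr v \<omega> \<le> y \<longleftrightarrow> (\<forall>t. v \<le> Z t \<omega> + g t * y)"
proof -
  obtain B where B: "\<And>s t. \<bar>cov s t\<bar> \<le> B" by (rule cov_bound) auto
  \<comment> \<open>A real supremum is informative only over a set bounded above; the lower bound
    \<open>1 - \<kappa>\<close> on \<open>g\<close> makes the bound uniform in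
    \<open>t\<close>.\<close>
  have "(v - Z t \<omega>) / g t \<le> (\<bar>v\<bar> + (1 + B / sd\<^sup>2) * norm (X \<omega>)) / (1 - \<kappa>)" for t
    using abs_Z_le[OF g_le[OF B], of t \<omega>] g_ge[of t] g_pos[of t] \<kappa> by (intro frac_le) auto
  then have "bdd_above (range (\<lambda>t. (v - Z t \<omega>) / g t))" by (intro bdd_aboveI2)
  then have "thr v \<omega> \<le> y \<longleftrightarrow> (\<forall>t. (v - Z t \<omega>) / g t \<le> y)"
    unfolding thr_def by (subst cSUP_le_iff) auto
  also have "\<dots> \<longleftrightarrow> (\<forall>t. v \<le> Z t \<omega> + g t * y)"
    using g_pos by (auto simp: pos_divide_le_eq algebra_simps)
  finally show ?thesis .
qed

lemma thr_bound: "v \<le> Z t \<omega> + g t * thr v \<omega>"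
  using thr_le_iff[of v \<omega> "thr v \<omega>"] by simp

lemma thr_ge: "v \<le> thr v \<omega>"
  using average_Z thr_bound by blast

lemma thr_shift_le:
  assumes "0 \<le> \<delta>"
  shows "thr (v + \<delta>) \<omega> \<le> thr v \<omega> + \<delta> / (1 - \<kappa>)"
  unfolding thr_le_iff
proof
  fix t
  have "\<delta> = (1 - \<kappa>) * (\<delta> / (1 - \<kappa>))" using \<kappa> by simp
  also have "\<dots> \<le> g t * (\<delta> / (1 - \<kappa>))" using g_ge assms \<kappa> by (intro mult_right_mono) auto
  finally show "v + \<delta> \<le> Z t \<omega> + g t * (thr v \<omega> + \<delta> / (1 - \<kappa>))"
    using thr_bound[of v t \<omega>] by (simp add: distrib_left)
qed

lemma thr_shift_ge:
  assumes \<epsilon>: "0 < \<epsilon>" and u: "0 \<le> u" and \<delta>: "0 \<le> \<delta>" and Z: "\<And>t. \<bar>Z t \<omega>\<bar> \<le> \<epsilon> * u"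
  shows "thr u \<omega> + \<delta> / (1 + 2 * \<epsilon>) \<le> thr (u + \<delta>) \<omega>"
proof -
  \<comment> \<open>\<open>thr u \<omega>\<close> is the least value of \<open>Y\<close> compatible
    with level \<open>u\<close>, so it suffices that \<open>?y\<close> is compatible.\<close>
  let ?y = "thr (u + \<delta>) \<omega> - \<delta> / (1 + 2 * \<epsilon>)"
  have "u \<le> Z t \<omega> + g t * ?y" for t
  proof (cases "g t \<le> 1 + 2 * \<epsilon>")
    case True
    then have "g t * (\<delta> / (1 + 2 * \<epsilon>)) \<le> (1 + 2 * \<epsilon>) * (\<delta> / (1 + 2 * \<epsilon>))"
      using \<delta> \<epsilon> by (intro mult_right_mono) auto
    then have "g t * (\<delta> / (1 + 2 * \<epsilon>)) \<le> \<delta>" using \<epsilon> by simp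
    then show ?thesis using thr_bound[of "u + \<delta>" t \<omega>] by (simp add: right_diff_distrib)
  next
    \<comment> \<open>By \<open>thr_ge\<close> at the raised level, \<open>?y\<close> is still at
      least \<open>u\<close>. A coefficient above \<open>1 + 2 * \<epsilon>\<close> then leaves a
      margin over \<open>u\<close> that \<open>Z\<close> cannot use up.\<close>
    case False
    have "\<delta> / (1 + 2 * \<epsilon>) \<le> \<delta>" using \<delta> \<epsilon> by (simp add: divide_le_eq mult_left_le algebra_simps)
    then have y: "u \<le> ?y" using thr_ge[of "u + \<delta>" \<omega>] by linarith
    have "\<epsilon> * u + u \<le> (1 + 2 * \<epsilon>) * u" using \<epsilon> u by (simp add: algebra_simps)
    also have "\<dots> \<le> g t * ?y" using False y u g_pos[of t] by (intro mult_mono) auto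
    finally show ?thesis using Z[of t] by linarith
  qed
  then have "thr u \<omega> \<le> ?y" by (simp add: thr_le_iff)
  then show ?thesis by linarith
qed

lemma thr_le:
  assumes u: "0 \<le> u" and k: "0 \<le> k" and Z: "\<And>t. \<bar>Z t \<omega>\<bar> \<le> k"
  shows "thr u \<omega> \<le> (u + k) / (1 - \<kappa>)"
  unfolding thr_le_iff
proof
  fix t
  have "u + k = (1 - \<kappa>) * ((u + k) / (1 - \<kappa>))" using \<kappa> by simp
  also have "\<dots> \<le> g t * ((u + k) / (1 - \<kappa>))" using g_ge u k \<kappa> by (intro mult_right_mono) auto
  finally show "u \<le> Z t \<omega> + g t * ((u + k) / (1 - \<kappa>))" using Z[of t] by linarith
qed

text \<open>
  \<open>Z\<close> is independent of \<open>Y\<close>, so \<open>Y\<close> may be replaced by an independent copy; given \<open>Z\<close>, the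
  event that the path stays above \<open>v\<close> is the half-line event \<open>Y \<ge> thr v\<close>.
\<close>

lemma min_tail_eq:
  "min_tail v = expectation (\<lambda>\<omega>. gauss_tail sd (thr v \<omega>))"
  "integrable P (\<lambda>\<omega>. gauss_tail sd (thr v \<omega>))"
proof -
  interpret PP: pair_prob_space P P ..
  obtain D :: "'k set" where D: "countable D" "closure D = UNIV"
    by (rule compact_UNIV_countable_dense[OF compact_K])
  note dense = continuous_ge_iff_dense[OF D(2)]
  have "{f \<in> space (PiM UNIV (\<lambda>_. borel)). \<forall>t\<in>D. v \<le> f t} \<in> sets (PiM UNIV (\<lambda>_::'k. borel :: real measure))" 
    using D(1) by measurable
  then have E: "{f. \<forall>t\<in>D. v \<le> f t} \<in> sets (PiM UNIV (\<lambda>_::'k. borel :: real measure))"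
    by (simp add: space_PiM)
  have ZL: "Z t \<in> lincomb" for t
    unfolding Z_def[abs_def] by (intro lincomb_add lincomb_scale lincomb_eval Y_lincomb)
  note [measurable] = ZL[THEN lincomb_law(1)]
  have gY: "expectation (\<lambda>\<omega>. Y \<omega> * apply_bcontfun (X \<omega>) t) = g t * sd\<^sup>2" for t
    using sd(1) by (simp add: g_def)
  \<comment> \<open>The \<open>+ 0\<close> brings \<open>X\<close> into the two-part form of
    \<open>pair_law_eqI\<close>. On the other side the residual covariance is that of
    \<open>X\<close> minus \<open>g s * g t * sd\<^sup>2\<close>, which the independent copy of
    \<open>Y\<close> restores.\<close>
  have "distr (P \<Otimes>\<^sub>M P) (PiM UNIV (\<lambda>_. borel)) (\<lambda>\<omega> t. apply_bcontfun (X (fst \<omega>)) t + 0) =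
     distr (P \<Otimes>\<^sub>M P) (PiM UNIV (\<lambda>_. borel)) (\<lambda>\<omega> t. Z t (fst \<omega>) + g t * Y (snd \<omega>))"
  proof (rule pair_law_eqI[of "\<lambda>t \<omega>. apply_bcontfun (X \<omega>) t" "\<lambda>t \<omega>. 0" Z "\<lambda>t \<omega>. g t * Y \<omega>"])
    fix s t
    have "expectation (\<lambda>\<omega>. Z s \<omega> * Z t \<omega>) = expectation (\<lambda>\<omega>. apply_bcontfun (X \<omega>) s * apply_bcontfun (X \<omega>) t
       - g t * (Y \<omega> * apply_bcontfun (X \<omega>) s) - g s * (Y \<omega> * apply_bcontfun (X \<omega>) t) + g s * g t * (Y \<omega>)\<^sup>2)"
      by (intro Bochner_Integration.integral_cong) (auto simp: Z_def power2_eq_square algebra_simps)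
    also have "\<dots> = expectation (\<lambda>\<omega>. apply_bcontfun (X \<omega>) s * apply_bcontfun (X \<omega>) t) - g s * g t * sd\<^sup>2"
      using lincomb_integrable_mult[OF lincomb_eval lincomb_eval, of s t] lincomb_integrable_mult[OF Y_lincomb lincomb_eval]
        lincomb_moments(2)[OF Y_lincomb]
      by (simp add: gY flip: sd(2))
    also have "g s * g t * sd\<^sup>2 = expectation (\<lambda>\<omega>. (g s * Y \<omega>) * (g t * Y \<omega>))"
      unfolding sd(2) integral_mult_right_zero[symmetric]
      by (intro Bochner_Integration.integral_cong) (auto simp: power2_eq_square)
    finally show "expectation (\<lambda>\<omega>. apply_bcontfun (X \<omega>) s * apply_bcontfun (X \<omega>) t) + expectation (\<lambda>\<omega>. 0 * 0) =
       expectation (\<lambda>\<omega>. Z s \<omega> * Z t \<omega>) + expectation (\<lambda>\<omega>. (g s * Y \<omega>) * (g t * Y \<omega>))"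
      by simp
  qed (auto intro: lincomb_eval lincomb_zero ZL lincomb_scale Y_lincomb)
  from arg_cong[OF this, of "\<lambda>M. measure M {f. \<forall>t\<in>D. v \<le> f t}"]
  have eq: "PP.P.prob ((\<lambda>\<omega> t. apply_bcontfun (X (fst \<omega>)) t + 0) -` {f. \<forall>t\<in>D. v \<le> f t} \<inter> space (P \<Otimes>\<^sub>M P))
    = PP.P.prob ((\<lambda>\<omega> t. Z t (fst \<omega>) + g t * Y (snd \<omega>)) -` {f. \<forall>t\<in>D. v \<le> f t} \<inter> space (P \<Otimes>\<^sub>M P))"
    by (subst (asm) (1 2) measure_distr[OF _ E]) (auto intro!: measurable_PiM_single')
  have D1: "{\<omega> \<in> space P. \<forall>t. v \<le> apply_bcontfun (X \<omega>) t} = {\<omega> \<in> space P. \<forall>t\<in>D. v \<le> apply_bcontfun (X \<omega>) t}"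
    using dense[OF continuous_on_apply_bcontfun] by auto
  define G where "G = {\<omega> \<in> space (P \<Otimes>\<^sub>M P). \<forall>t\<in>D. v \<le> Z t (fst \<omega>) + g t * Y (snd \<omega>)}"
  have G: "G \<in> sets (P \<Otimes>\<^sub>M P)" unfolding G_def using D(1) by measurable
  have "min_tail v = PP.P.prob ({\<omega> \<in> space P. \<forall>t. v \<le> apply_bcontfun (X \<omega>) t} \<times> space P)"
    unfolding min_tail_def by (subst prob_Times[OF path_ge_events]) (auto simp: prob_space)
  also have "{\<omega> \<in> space P. \<forall>t. v \<le> apply_bcontfun (X \<omega>) t} \<times> space P = (\<lambda>\<omega> t. apply_bcontfun (X (fst \<omega>)) t + 0) -` {f. \<forall>t\<in>D. v \<le> f t} \<inter> space (P \<Otimes>\<^sub>M P)"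
    unfolding D1 by (auto simp: space_pair_measure)
  also have "PP.P.prob \<dots> = PP.P.prob ((\<lambda>\<omega> t. Z t (fst \<omega>) + g t * Y (snd \<omega>)) -` {f. \<forall>t\<in>D. v \<le> f t} \<inter> space (P \<Otimes>\<^sub>M P))"
    by (rule eq)
  also have "(\<lambda>\<omega> t. Z t (fst \<omega>) + g t * Y (snd \<omega>)) -` {f. \<forall>t\<in>D. v \<le> f t} \<inter> space (P \<Otimes>\<^sub>M P) = G"
    by (auto simp: G_def)
  finally have 1: "min_tail v = PP.P.prob G" .
  have int: "integrable (P \<Otimes>\<^sub>M P) (indicator G :: _ \<Rightarrow> real)"
    using G by (intro integrable_real_indicator) (auto simp: PP.P.emeasure_eq_measure)
  have inner: "(\<integral>\<omega>'. indicator G (\<omega>, \<omega>') \<partial>P) = gauss_tail sd (thr v \<omega>)" if "\<omega> \<in> space P" for \<omega>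
  proof -
    have "continuous_on UNIV (\<lambda>t. Z t \<omega> + g t * y)" for y
      unfolding Z_def by (intro continuous_intros continuous_on_apply_bcontfun continuous_g)
    from dense[OF this] have "(\<integral>\<omega>'. indicator G (\<omega>, \<omega>') \<partial>P) = (\<integral>\<omega>'. indicator {\<omega>' \<in> space P. thr v \<omega> \<le> Y \<omega>'} \<omega>' \<partial>P :: real)"
      using that by (intro Bochner_Integration.integral_cong) (auto simp: G_def indicator_def space_pair_measure thr_le_iff)
    also have "\<dots> = prob {\<omega>' \<in> space P. thr v \<omega> \<le> Y \<omega>'}" by simp
    also have "\<dots> = gauss_tail sd (thr v \<omega>)"
      using lincomb_moments(3)[OF Y_lincomb] sd(1) by (intro gaussian_law_tail) (auto simp: sd_def)
    finally show ?thesis .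
  qed
  have "PP.P.prob G = (\<integral>\<omega>. (\<integral>\<omega>'. indicator G (\<omega>, \<omega>') \<partial>P) \<partial>P)"
    using PP.integral_fst'[OF int] G by simp
  then show "min_tail v = expectation (\<lambda>\<omega>. gauss_tail sd (thr v \<omega>))"
    using inner 1 by (simp cong: Bochner_Integration.integral_cong)
  show "integrable P (\<lambda>\<omega>. gauss_tail sd (thr v \<omega>))"
    using PP.integrable_fst'[OF int] inner by (simp cong: Bochner_Integration.integrable_cong)
qed

lemma min_tail_shift_ge:
  assumes "0 \<le> \<delta>" and b: "0 \<le> b"
  shows "exp (- (2 * b * (\<delta> / (1 - \<kappa>)) + (\<delta> / (1 - \<kappa>))\<^sup>2) / (2 * sd\<^sup>2)) * (min_tail u - gauss_tail sd b) \<le> min_tail (u + \<delta>)"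
proof -
  let ?\<delta> = "\<delta> / (1 - \<kappa>)"
  let ?e = "exp (- (2 * b * ?\<delta> + ?\<delta>\<^sup>2) / (2 * sd\<^sup>2))"
  have \<delta>: "0 \<le> ?\<delta>" using assms(1) \<kappa> by simp
  have "?e * (min_tail u - gauss_tail sd b) = expectation (\<lambda>\<omega>. ?e * (gauss_tail sd (thr u \<omega>) - gauss_tail sd b))"
    using min_tail_eq[of u] by (subst integral_mult_right_zero) (simp add: Bochner_Integration.integral_diff prob_space)
  also have "\<dots> \<le> expectation (\<lambda>\<omega>. gauss_tail sd (thr (u + \<delta>) \<omega>))"
  proof (intro integral_mono min_tail_eq(2) integrable_mult_right Bochner_Integration.integrable_diff integrable_const)
    fix \<omega>
    have "?e * (gauss_tail sd (thr u \<omega>) - gauss_tail sd b) \<le> gauss_tail sd (thr u \<omega> + ?\<delta>)"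
      by (rule gauss_tail_shift_ge[OF sd(1) \<delta>])
    also have "\<dots> \<le> gauss_tail sd (thr (u + \<delta>) \<omega>)"
      by (intro gauss_tail_antimono sd(1) thr_shift_le assms(1))
    finally show "?e * (gauss_tail sd (thr u \<omega>) - gauss_tail sd b) \<le> gauss_tail sd (thr (u + \<delta>) \<omega>)" .
  qed
  finally show ?thesis by (simp add: min_tail_eq(1))
qed

text \<open>The exponential factor is gained where all residuals are small. Elsewhere only
  \<open>thr \<ge> u\<close> is used, so the error is a product of two tails: the tail of
  \<open>Y\<close> at \<open>u\<close> multiplies the probability of a large norm and is
  indispensable, as that probability alone need not be small relative to
  \<open>min_tail u\<close>.\<close>

lemma min_tail_shift_le:
  assumes \<epsilon>: "0 < \<epsilon>" and u: "0 \<le> u" and \<delta>: "0 \<le> \<delta>" and C: "\<And>t. g t \<le> C"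
  shows "min_tail (u + \<delta>) \<le> exp (- (u * (\<delta> / (1 + 2 * \<epsilon>))) / sd\<^sup>2) * min_tail u
     + gauss_tail sd u * prob {\<omega> \<in> space P. norm (X \<omega>) > \<epsilon> * u / (1 + C)}"
proof -
  let ?\<delta> = "\<delta> / (1 + 2 * \<epsilon>)"
  let ?e = "exp (- (u * ?\<delta>) / sd\<^sup>2)"
  let ?N = "{\<omega> \<in> space P. norm (X \<omega>) > \<epsilon> * u / (1 + C)}"
  have \<delta>': "0 \<le> ?\<delta>" using \<delta> \<epsilon> by simp
  have C1: "1 + C > 0" using C[of undefined] g_pos[of undefined] by linarith
  have "expectation (\<lambda>\<omega>. gauss_tail sd (thr (u + \<delta>) \<omega>)) \<le> expectation (\<lambda>\<omega>. ?e * gauss_tail sd (thr u \<omega>) + gauss_tail sd u * indicator ?N \<omega>)"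
  proof (intro integral_mono Bochner_Integration.integrable_add min_tail_eq(2) integrable_mult_right)
    show "integrable P (indicator ?N :: _ \<Rightarrow> real)"
      by (intro integrable_real_indicator) (auto simp: emeasure_eq_measure)
    fix \<omega> assume \<omega>: "\<omega> \<in> space P"
    show "gauss_tail sd (thr (u + \<delta>) \<omega>) \<le> ?e * gauss_tail sd (thr u \<omega>) + gauss_tail sd u * indicator ?N \<omega>"
    proof (cases "\<omega> \<in> ?N")
      case True
      have "gauss_tail sd (thr (u + \<delta>) \<omega>) \<le> gauss_tail sd u"
        using thr_ge[of "u + \<delta>" \<omega>] \<delta> by (intro gauss_tail_antimono sd(1)) linarith
      moreover have "0 \<le> ?e * gauss_tail sd (thr u \<omega>)" by (simp add: gauss_tail_nonneg)
      ultimately show ?thesis using True by simp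
    next
      case False
      then have "(1 + C) * norm (X \<omega>) \<le> \<epsilon> * u" using \<omega> C1 by (simp add: not_less pos_le_divide_eq mult.commute)
      then have "\<bar>Z t \<omega>\<bar> \<le> \<epsilon> * u" for t using abs_Z_le[OF C, of t \<omega>] by linarith
      then have "gauss_tail sd (thr (u + \<delta>) \<omega>) \<le> gauss_tail sd (thr u \<omega> + ?\<delta>)"
        by (intro gauss_tail_antimono sd(1) thr_shift_ge \<epsilon> u \<delta>)
      also have "\<dots> \<le> exp (- (2 * thr u \<omega> * ?\<delta> + ?\<delta>\<^sup>2) / (2 * sd\<^sup>2)) * gauss_tail sd (thr u \<omega>)"
        by (rule gauss_tail_shift_le[OF sd(1) \<delta>'])
      also have "\<dots> \<le> ?e * gauss_tail sd (thr u \<omega>)"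
      proof (intro mult_right_mono gauss_tail_nonneg)
        have "u * ?\<delta> \<le> thr u \<omega> * ?\<delta>" using thr_ge \<delta>' by (intro mult_right_mono)
        then have "- (2 * thr u \<omega> * ?\<delta> + ?\<delta>\<^sup>2) \<le> - (2 * (u * ?\<delta>))"
          using zero_le_power2[of ?\<delta>] unfolding mult.assoc by linarith
        then have "- (2 * thr u \<omega> * ?\<delta> + ?\<delta>\<^sup>2) / (2 * sd\<^sup>2) \<le> - (2 * (u * ?\<delta>)) / (2 * sd\<^sup>2)"
          by (intro divide_right_mono) auto
        also have "\<dots> = - (u * ?\<delta>) / sd\<^sup>2" by simp
        finally show "exp (- (2 * thr u \<omega> * ?\<delta> + ?\<delta>\<^sup>2) / (2 * sd\<^sup>2)) \<le> ?e" by (simp only: exp_le_cancel_iff)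
      qed
      finally show ?thesis using False by simp
    qed
  qed
  also have "\<dots> = ?e * min_tail u + gauss_tail sd u * prob ?N"
    using min_tail_eq[of u] by (subst Bochner_Integration.integral_add) (auto intro!: integrable_mult_right integrable_real_indicator simp: emeasure_eq_measure)
  finally show ?thesis by (simp add: min_tail_eq(1))
qed

text \<open>When the norm is at most \<open>c\<close>, the residuals are bounded independently of
  \<open>u\<close>, so the threshold is at most \<open>u / (1 - \<kappa>)\<close> plus a
  constant.\<close>

lemma min_tail_ge:
  assumes u: "0 \<le> u" and c: "0 \<le> c" and C: "\<And>t. g t \<le> C"
  shows "prob {\<omega> \<in> space P. norm (X \<omega>) \<le> c} * gauss_tail sd ((u + (1 + C) * c) / (1 - \<kappa>)) \<le> min_tail u"
proof -
  let ?N = "{\<omega> \<in> space P. norm (X \<omega>) \<le> c}"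
  let ?a = "(u + (1 + C) * c) / (1 - \<kappa>)"
  have C1: "1 + C > 0" using C[of undefined] g_pos[of undefined] by linarith
  have "prob ?N * gauss_tail sd ?a = expectation (\<lambda>\<omega>. indicator ?N \<omega> * gauss_tail sd ?a)"
    by simp
  also have "\<dots> \<le> expectation (\<lambda>\<omega>. gauss_tail sd (thr u \<omega>))"
  proof (intro integral_mono min_tail_eq(2) integrable_mult_left)
    show "integrable P (indicator ?N :: _ \<Rightarrow> real)"
      by (intro integrable_real_indicator) (auto simp: emeasure_eq_measure)
    fix \<omega>
    show "indicator ?N \<omega> * gauss_tail sd ?a \<le> gauss_tail sd (thr u \<omega>)"
    proof (cases "\<omega> \<in> ?N")
      case True
      then have "(1 + C) * norm (X \<omega>) \<le> (1 + C) * c" using C1 by (intro mult_left_mono) auto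
      then have "\<bar>Z t \<omega>\<bar> \<le> (1 + C) * c" for t using abs_Z_le[OF C, of t \<omega>] by linarith
      then have "gauss_tail sd ?a \<le> gauss_tail sd (thr u \<omega>)"
        using C1 c u by (intro gauss_tail_antimono sd(1) thr_le) auto
      then show ?thesis using True by simp
    qed (simp add: gauss_tail_nonneg)
  qed
  finally show ?thesis by (simp add: min_tail_eq(1))
qed

end

section \<open>Asymptotics of the minimum\<close>

context gaussian_element
begin

lemma min_tail_nonneg: "0 \<le> min_tail v"
  by (simp add: min_tail_def)

lemma min_tail_ratio_bounds:
  assumes pos: "min_energy cov > 0" and x: "0 \<le> x" and \<epsilon>: "0 < \<epsilon>"
  shows "\<forall>\<^sub>F u in at_top. 0 < min_tail u \<and>
    min_tail (u + x / u) \<le> (exp (- (x / ((1 + 2 * \<epsilon>) * ((1 + \<epsilon>) * min_energy cov)))) + \<epsilon>) * min_tail u \<and>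
    (exp (- ((1 + \<epsilon>)\<^sup>2 * x / min_energy cov)) - \<epsilon>) * min_tail u \<le> min_tail (u + x / u)"
proof -
  define \<sigma> where "\<sigma> = min_energy cov"
  have \<sigma>: "\<sigma> > 0" using pos by (simp add: \<sigma>_def)
  obtain B where B: "B > 0" "\<And>s t. \<bar>cov s t\<bar> \<le> B" by (rule cov_bound) blast
  define C where "C = B / \<sigma>"
  have C: "C > 0" using B \<sigma> by (simp add: C_def)
  obtain \<alpha> K where \<alpha>: "\<alpha> > 0" "K > 0" "\<And>v. v \<ge> 0 \<Longrightarrow> prob {\<omega> \<in> space P. norm (X \<omega>) > v} \<le> K * exp (- \<alpha> * v\<^sup>2)"
    using fernique by auto
  obtain c where c: "c > 0" "prob {\<omega> \<in> space P. norm (X \<omega>) > c} < 1/2"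
    using norm_large_exists[of "1/2"] by auto
  have "prob {\<omega> \<in> space P. norm (X \<omega>) \<le> c} = 1 - prob {\<omega> \<in> space P. norm (X \<omega>) > c}"
    by (subst prob_compl[symmetric]) (auto intro!: arg_cong[of _ _ prob])
  then have half: "1 / 2 \<le> prob {\<omega> \<in> space P. norm (X \<omega>) \<le> c}" using c by simp
  \<comment> \<open>Fernique's rate at norm level \<open>\<epsilon> * u / (1 + C)\<close>, below
    which \<open>abs_Z_le\<close> keeps all residuals within \<open>\<epsilon> * u\<close>.\<close>
  define \<beta> where "\<beta> = \<alpha> * (\<epsilon> / (1 + C))\<^sup>2"
  have \<beta>: "\<beta> > 0" using \<alpha> \<epsilon> C by (simp add: \<beta>_def)
  \<comment> \<open>A common rate for both errors: the first bound serves large \<open>Y\<close>,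
    the second serves large residuals combined with \<open>Y\<close> at \<open>u\<close>. The
    variance is not yet chosen, so its lower bound \<sigma> stands in for it.\<close>
  define \<rho> where "\<rho> = min (1 + \<epsilon>) (sqrt (1 + 2 * \<sigma> * \<beta>))"
  have \<rho>1: "1 < \<rho>" "\<rho> \<le> 1 + \<epsilon>" using \<epsilon> \<sigma> \<beta> by (auto simp: \<rho>_def)
  have "\<rho>\<^sup>2 \<le> (sqrt (1 + 2 * \<sigma> * \<beta>))\<^sup>2" using \<rho>1 by (intro power_mono) (auto simp: \<rho>_def)
  then have \<rho>2: "\<rho>\<^sup>2 \<le> 1 + 2 * \<sigma> * \<beta>" using \<sigma> \<beta> by simp
  \<comment> \<open>Staying strictly below \<open>1 - 1 / \<rho>\<close> is equivalent to
    \<open>a < \<rho>\<close>: the lower bound for \<open>min_tail u\<close> then decays more slowly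
    than both errors.\<close>
  define \<kappa> where "\<kappa> = min \<epsilon> ((1 - 1 / \<rho>) / 2)"
  have \<kappa>: "0 < \<kappa>" "\<kappa> \<le> \<epsilon>" "\<kappa> < 1 - 1 / \<rho>" using \<epsilon> \<rho>1 by (auto simp: \<kappa>_def min_def field_simps)
  have "0 < 1 / \<rho>" using \<rho>1 by simp
  then have \<kappa>1: "\<kappa> < 1" using \<kappa>(3) by linarith
  define a where "a = 1 / (1 - \<kappa>)"
  have a: "0 < a" "a < \<rho>"
    using \<kappa> \<kappa>1 \<rho>1 by (auto simp: a_def field_simps)
  obtain Y where Y: "Y \<in> convcomb" "\<sigma> \<le> expectation (\<lambda>\<omega>. (Y \<omega>)\<^sup>2)"
    "expectation (\<lambda>\<omega>. (Y \<omega>)\<^sup>2) \<le> (1 + \<kappa>) * \<sigma>"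
    "\<And>t. expectation (\<lambda>\<omega>. Y \<omega> * apply_bcontfun (X \<omega>) t) \<ge> (1 - \<kappa>) * expectation (\<lambda>\<omega>. (Y \<omega>)\<^sup>2)"
    unfolding \<sigma>_def by (rule almost_equilibrium[OF pos \<kappa>(1)]) blast
  interpret R: gaussian_regression P X Y \<kappa>
    by unfold_locales (use Y \<sigma> \<kappa> \<kappa>1 in auto)
  have sd: "0 < R.sd" "\<sigma> \<le> R.sd\<^sup>2" "R.sd\<^sup>2 \<le> (1 + \<kappa>) * \<sigma>"
    using R.sd(1) Y(2,3) by (simp_all add: R.sd(2))
  have sd2: "0 < R.sd\<^sup>2" using sd by simp
  have gC: "R.g t \<le> C" for t
  proof -
    have "B / R.sd\<^sup>2 \<le> C" unfolding C_def using B \<sigma> sd by (intro divide_left_mono) auto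
    with R.g_le[OF B(2), of t] show ?thesis by linarith
  qed
  define q where "q = sqrt (2 * pi * R.sd\<^sup>2)"
  have q: "q > 0" using sd2 by (simp add: q_def)
  \<comment> \<open>The summand \<open>1 - \<kappa>\<close> is the unit shift of
    \<open>gauss_tail_ge_exp\<close>, multiplied by \<open>1 - \<kappa>\<close> so that
    \<open>a\<close> can be factored out. \<open>E\<close> then measures the error scale against
    this lower bound.\<close>
  define k where "k = (1 + C) * c + (1 - \<kappa>)"
  define E where "E u = exp (((a * (u + k))\<^sup>2 - (\<rho> * u)\<^sup>2) / (2 * R.sd\<^sup>2))" for u
  have E0: "(E \<longlongrightarrow> 0) at_top"
    unfolding E_def[abs_def] using a sd2 by (intro exp_quadratic_gap_tendsto_0) auto
  have lower: "exp (- (a * (u + k))\<^sup>2 / (2 * R.sd\<^sup>2)) \<le> 2 * q * min_tail u" if "0 \<le> u" for u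
  proof -
    let ?b = "(u + (1 + C) * c) / (1 - \<kappa>)"
    have "?b + 1 = a * (u + k)" using \<kappa>1 by (simp add: a_def k_def field_simps)
    moreover have "0 \<le> ?b" using that C c \<kappa>1 by simp
    ultimately have "exp (- (a * (u + k))\<^sup>2 / (2 * R.sd\<^sup>2)) / q \<le> gauss_tail R.sd ?b"
      using gauss_tail_ge_exp[OF sd(1), of ?b] by (simp add: q_def)
    also have "1 / 2 * gauss_tail R.sd ?b \<le> prob {\<omega> \<in> space P. norm (X \<omega>) \<le> c} * gauss_tail R.sd ?b"
      by (intro mult_right_mono half gauss_tail_nonneg)
    then have "gauss_tail R.sd ?b \<le> 2 * min_tail u"
      using R.min_tail_ge[OF that _ gC, of c] c by simp
    finally show ?thesis using q by (simp add: pos_divide_le_eq mult.commute mult.left_commute)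
  qed
  have E_lower: "exp (- (\<rho> * u)\<^sup>2 / (2 * R.sd\<^sup>2)) \<le> 2 * q * E u * min_tail u" if "0 \<le> u" for u
  proof -
    have "exp (- (\<rho> * u)\<^sup>2 / (2 * R.sd\<^sup>2)) = E u * exp (- (a * (u + k))\<^sup>2 / (2 * R.sd\<^sup>2))"
      unfolding E_def exp_add[symmetric] by (simp add: diff_divide_distrib)
    also have "\<dots> \<le> E u * (2 * q * min_tail u)"
      using lower[OF that] by (intro mult_left_mono) (auto simp: E_def)
    finally show ?thesis by (simp add: ac_simps)
  qed
  have bad1: "gauss_tail R.sd ((1 + \<epsilon>) * u) \<le> 2 * q * E u * min_tail u" if "0 \<le> u" for u
  proof -
    have "gauss_tail R.sd ((1 + \<epsilon>) * u) \<le> exp (- ((1 + \<epsilon>) * u)\<^sup>2 / (2 * R.sd\<^sup>2))"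
      using that \<epsilon> by (intro gauss_tail_le_exp sd) auto
    also have "\<dots> \<le> exp (- (\<rho> * u)\<^sup>2 / (2 * R.sd\<^sup>2))"
    proof -
      have "(\<rho> * u)\<^sup>2 \<le> ((1 + \<epsilon>) * u)\<^sup>2" using \<rho>1 that by (intro power_mono mult_right_mono) auto
      then show ?thesis by (simp add: divide_right_mono)
    qed
    finally show ?thesis using E_lower[OF that] by linarith
  qed
  have bad2: "gauss_tail R.sd u * prob {\<omega> \<in> space P. norm (X \<omega>) > \<epsilon> * u / (1 + C)} \<le> K * (2 * q * E u) * min_tail u" if "0 \<le> u" for u
  proof -
    have "prob {\<omega> \<in> space P. norm (X \<omega>) > \<epsilon> * u / (1 + C)} \<le> K * exp (- \<alpha> * (\<epsilon> * u / (1 + C))\<^sup>2)"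
      using that \<epsilon> C by (intro \<alpha>(3)) auto
    also have "- \<alpha> * (\<epsilon> * u / (1 + C))\<^sup>2 = - \<beta> * u\<^sup>2" by (simp add: \<beta>_def power_divide power_mult_distrib)
    finally have "gauss_tail R.sd u * prob {\<omega> \<in> space P. norm (X \<omega>) > \<epsilon> * u / (1 + C)} \<le> exp (- u\<^sup>2 / (2 * R.sd\<^sup>2)) * (K * exp (- \<beta> * u\<^sup>2))"
      using that \<alpha> by (intro mult_mono gauss_tail_le_exp sd) auto
    also have "\<dots> = K * exp (- u\<^sup>2 / (2 * R.sd\<^sup>2) - \<beta> * u\<^sup>2)" by (simp add: exp_diff exp_minus field_simps)
    also have "\<dots> \<le> K * exp (- (\<rho> * u)\<^sup>2 / (2 * R.sd\<^sup>2))"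
    proof -
      have "2 * \<sigma> * \<beta> \<le> 2 * R.sd\<^sup>2 * \<beta>" using sd(2) \<beta> by (intro mult_right_mono) auto
      with \<rho>2 have "\<rho>\<^sup>2 \<le> 1 + 2 * R.sd\<^sup>2 * \<beta>" by linarith
      then have "(\<rho> * u)\<^sup>2 \<le> (1 + 2 * R.sd\<^sup>2 * \<beta>) * u\<^sup>2" unfolding power_mult_distrib by (intro mult_right_mono) auto
      then have "(\<rho> * u)\<^sup>2 / (2 * R.sd\<^sup>2) \<le> (1 + 2 * R.sd\<^sup>2 * \<beta>) * u\<^sup>2 / (2 * R.sd\<^sup>2)"
        using sd2 by (intro divide_right_mono) auto
      also have "\<dots> = u\<^sup>2 / (2 * R.sd\<^sup>2) + \<beta> * u\<^sup>2" using sd(1) by (simp add: field_simps)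
      finally show ?thesis using \<alpha>(2) by simp
    qed
    also have "\<dots> \<le> K * (2 * q * E u * min_tail u)" using E_lower[OF that] \<alpha>(2) by (intro mult_left_mono) auto
    finally show ?thesis by (simp add: ac_simps)
  qed
  have ev1: "\<forall>\<^sub>F u in at_top. K * (2 * q * E u) < \<epsilon>"
  proof (rule order_tendstoD)
    show "((\<lambda>u. K * (2 * q * E u)) \<longlongrightarrow> K * (2 * q * 0)) at_top" by (intro tendsto_intros E0)
  qed (use \<epsilon> in simp)
  \<comment> \<open>The prefactor of \<open>min_tail_shift_ge\<close> with cutoff
    \<open>(1 + \<epsilon>) * u\<close> and shift \<open>x / u\<close>: the factor \<open>u\<close>
    cancels in the linear term, and the quadratic term, written with \<open>inverse u\<close>,
    vanishes in the limit.\<close>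
  define L where "L u = exp (- (2 * ((1 + \<epsilon>) * (x * a)) + (x * a)\<^sup>2 * (inverse u)\<^sup>2) / (2 * R.sd\<^sup>2))" for u
  have Lim: "((\<lambda>u. L u * (1 - 2 * q * E u)) \<longlongrightarrow> exp (- (2 * ((1 + \<epsilon>) * (x * a)) + (x * a)\<^sup>2 * 0\<^sup>2) / (2 * R.sd\<^sup>2)) * (1 - 2 * q * 0)) at_top"
    unfolding L_def[abs_def] using sd2
    by (intro tendsto_intros E0 tendsto_inverse_0_at_top filterlim_ident) auto
  have "(1 + \<epsilon>) * (x * a) / R.sd\<^sup>2 \<le> (1 + \<epsilon>)\<^sup>2 * x / \<sigma>"
  proof (rule frac_le)
    have "(1 + \<epsilon>) * (x * a) \<le> (1 + \<epsilon>) * (x * (1 + \<epsilon>))"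
      using \<epsilon> x a \<rho>1 by (intro mult_left_mono) auto
    then show "(1 + \<epsilon>) * (x * a) \<le> (1 + \<epsilon>)\<^sup>2 * x" by (simp add: power2_eq_square ac_simps)
  qed (use \<epsilon> x \<sigma> sd in auto)
  then have "exp (- ((1 + \<epsilon>)\<^sup>2 * x / \<sigma>)) \<le> exp (- ((1 + \<epsilon>) * (x * a) / R.sd\<^sup>2))" by simp
  also have "\<dots> = exp (- (2 * ((1 + \<epsilon>) * (x * a)) + (x * a)\<^sup>2 * 0\<^sup>2) / (2 * R.sd\<^sup>2)) * (1 - 2 * q * 0)"
    using sd2 by (simp add: field_simps)
  finally have ev2: "\<forall>\<^sub>F u in at_top. exp (- ((1 + \<epsilon>)\<^sup>2 * x / \<sigma>)) - \<epsilon> < L u * (1 - 2 * q * E u)"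
    using \<epsilon> by (intro order_tendstoD(1)[OF Lim]) linarith
  show ?thesis
    using ev1 ev2 eventually_gt_at_top[of 0]
  proof eventually_elim
    case (elim u)
    have u: "0 < u" "0 \<le> u" using elim by auto
    have \<delta>: "0 \<le> x / u" using x u by simp
    have "0 < exp (- (a * (u + k))\<^sup>2 / (2 * R.sd\<^sup>2))" by simp
    also have "\<dots> \<le> 2 * q * min_tail u" by (rule lower[OF u(2)])
    finally have p: "0 < min_tail u" using q by (simp add: zero_less_mult_iff)
    have "min_tail (u + x / u) \<le> exp (- (u * (x / u / (1 + 2 * \<epsilon>))) / R.sd\<^sup>2) * min_tail u + \<epsilon> * min_tail u"
      using R.min_tail_shift_le[OF \<epsilon> u(2) \<delta> gC] bad2[OF u(2)] mult_right_mono[OF less_imp_le[OF elim(1)] min_tail_nonneg[of u]]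
      by linarith
    also have "exp (- (u * (x / u / (1 + 2 * \<epsilon>))) / R.sd\<^sup>2) \<le> exp (- (x / ((1 + 2 * \<epsilon>) * ((1 + \<epsilon>) * \<sigma>))))"
    proof -
      have "R.sd\<^sup>2 \<le> (1 + \<epsilon>) * \<sigma>" using sd(3) mult_right_mono[of "1 + \<kappa>" "1 + \<epsilon>" \<sigma>] \<kappa> \<sigma> by linarith
      then have "(1 + 2 * \<epsilon>) * R.sd\<^sup>2 \<le> (1 + 2 * \<epsilon>) * ((1 + \<epsilon>) * \<sigma>)" using \<epsilon> by (intro mult_left_mono) auto
      then have "x / ((1 + 2 * \<epsilon>) * ((1 + \<epsilon>) * \<sigma>)) \<le> x / ((1 + 2 * \<epsilon>) * R.sd\<^sup>2)"
        using x \<epsilon> sd2 \<sigma> by (intro divide_left_mono mult_pos_pos) auto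
      then show ?thesis using u by simp
    qed
    then have "exp (- (u * (x / u / (1 + 2 * \<epsilon>))) / R.sd\<^sup>2) * min_tail u + \<epsilon> * min_tail u \<le> (exp (- (x / ((1 + 2 * \<epsilon>) * ((1 + \<epsilon>) * \<sigma>)))) + \<epsilon>) * min_tail u"
      using p by (simp add: distrib_right)
    finally have up: "min_tail (u + x / u) \<le> (exp (- (x / ((1 + 2 * \<epsilon>) * ((1 + \<epsilon>) * \<sigma>)))) + \<epsilon>) * min_tail u" .
    have "(exp (- ((1 + \<epsilon>)\<^sup>2 * x / \<sigma>)) - \<epsilon>) * min_tail u \<le> L u * (1 - 2 * q * E u) * min_tail u"
      using elim(2) p by (intro mult_right_mono) auto
    also have "\<dots> = L u * (min_tail u - 2 * q * E u * min_tail u)" by (simp add: algebra_simps)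
    also have "\<dots> \<le> L u * (min_tail u - gauss_tail R.sd ((1 + \<epsilon>) * u))"
      using bad1[OF u(2)] by (intro mult_left_mono) (auto simp: L_def)
    also have "L u = exp (- (2 * ((1 + \<epsilon>) * u) * (x / u / (1 - \<kappa>)) + (x / u / (1 - \<kappa>))\<^sup>2) / (2 * R.sd\<^sup>2))"
    proof -
      have "2 * ((1 + \<epsilon>) * u) * (x / u / (1 - \<kappa>)) = 2 * ((1 + \<epsilon>) * (x * a))"
        using u(1) by (simp add: a_def)
      moreover have "(x / u / (1 - \<kappa>))\<^sup>2 = (x * a)\<^sup>2 * (inverse u)\<^sup>2"
        unfolding power_mult_distrib[symmetric] by (simp add: a_def divide_inverse mult.assoc mult.commute[of "inverse u"])
      ultimately show ?thesis unfolding L_def by (simp only:)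
    qed
    also have "\<dots> * (min_tail u - gauss_tail R.sd ((1 + \<epsilon>) * u)) \<le> min_tail (u + x / u)"
      using R.min_tail_shift_ge[OF \<delta>, of "(1 + \<epsilon>) * u" u] \<epsilon> u by simp
    finally show ?case using p up by (simp add: \<sigma>_def)
  qed
qed

lemma min_tail_eventually_pos:
  assumes "min_energy cov > 0"
  shows "\<forall>\<^sub>F u in at_top. 0 < min_tail u"
  using min_tail_ratio_bounds[OF assms order_refl zero_less_one] by eventually_elim auto

text \<open>For each level \<open>l\<close> one \<epsilon> is fixed whose bound already lies on the
  right side of \<open>l\<close>, so no uniformity in \<epsilon> as \<open>u\<close> grows is
  involved.\<close>

lemma min_tail_ratio_tendsto:
  assumes pos: "min_energy cov > 0" and x: "0 \<le> x"
  shows "((\<lambda>u. min_tail (u + x / u) / min_tail u) \<longlongrightarrow> exp (- (x / min_energy cov))) at_top"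
proof (rule order_tendstoI)
  fix l assume l: "l < exp (- (x / min_energy cov))"
  have "((\<lambda>\<epsilon>. exp (- ((1 + \<epsilon>)\<^sup>2 * x / min_energy cov)) - \<epsilon>) \<longlongrightarrow> exp (- ((1 + 0)\<^sup>2 * x / min_energy cov)) - 0) (at_right 0)"
    using pos by (intro tendsto_intros) auto
  then have "\<forall>\<^sub>F \<epsilon> in at_right 0. l < exp (- ((1 + \<epsilon>)\<^sup>2 * x / min_energy cov)) - \<epsilon>"
    using l by (intro order_tendstoD) auto
  then have "\<forall>\<^sub>F \<epsilon> in at_right 0. l < exp (- ((1 + \<epsilon>)\<^sup>2 * x / min_energy cov)) - \<epsilon> \<and> 0 < \<epsilon>"
    by (intro eventually_conj eventually_at_right_less)
  then obtain \<epsilon> where \<epsilon>: "l < exp (- ((1 + \<epsilon>)\<^sup>2 * x / min_energy cov)) - \<epsilon>" "0 < \<epsilon>"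
    using eventually_happens'[OF trivial_limit_at_right_real] by auto
  show "\<forall>\<^sub>F u in at_top. l < min_tail (u + x / u) / min_tail u"
    using min_tail_ratio_bounds[OF pos x \<epsilon>(2)]
  proof eventually_elim
    case (elim u)
    then have "exp (- ((1 + \<epsilon>)\<^sup>2 * x / min_energy cov)) - \<epsilon> \<le> min_tail (u + x / u) / min_tail u"
      by (simp add: pos_le_divide_eq)
    with \<epsilon>(1) show ?case by linarith
  qed
next
  fix l assume l: "exp (- (x / min_energy cov)) < l"
  have "((\<lambda>\<epsilon>. exp (- (x / ((1 + 2 * \<epsilon>) * ((1 + \<epsilon>) * min_energy cov)))) + \<epsilon>) \<longlongrightarrow> exp (- (x / ((1 + 2 * 0) * ((1 + 0) * min_energy cov)))) + 0) (at_right 0)"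
    using pos by (intro tendsto_intros) auto
  then have "\<forall>\<^sub>F \<epsilon> in at_right 0. exp (- (x / ((1 + 2 * \<epsilon>) * ((1 + \<epsilon>) * min_energy cov)))) + \<epsilon> < l"
    using l by (intro order_tendstoD) auto
  then have "\<forall>\<^sub>F \<epsilon> in at_right 0. exp (- (x / ((1 + 2 * \<epsilon>) * ((1 + \<epsilon>) * min_energy cov)))) + \<epsilon> < l \<and> 0 < \<epsilon>"
    by (intro eventually_conj eventually_at_right_less)
  then obtain \<epsilon> where \<epsilon>: "exp (- (x / ((1 + 2 * \<epsilon>) * ((1 + \<epsilon>) * min_energy cov)))) + \<epsilon> < l" "0 < \<epsilon>"
    using eventually_happens'[OF trivial_limit_at_right_real] by auto
  show "\<forall>\<^sub>F u in at_top. min_tail (u + x / u) / min_tail u < l"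
    using min_tail_ratio_bounds[OF pos x \<epsilon>(2)]
  proof eventually_elim
    case (elim u)
    then have "min_tail (u + x / u) / min_tail u \<le> exp (- (x / ((1 + 2 * \<epsilon>) * ((1 + \<epsilon>) * min_energy cov)))) + \<epsilon>"
      by (simp add: pos_divide_le_eq)
    with \<epsilon>(1) show ?case by linarith
  qed
qed

section \<open>Strict exceedances of the path minimum\<close>

lemma path_min_ge_iff: "v \<le> path_min x \<longleftrightarrow> (\<forall>t. v \<le> apply_bcontfun x t)" for x :: "'k \<Rightarrow>\<^sub>C real"
  by (rule path_min_attained[OF compact_K, of x]) (auto intro: order_trans)

lemma path_min_measurable[measurable]: "(\<lambda>\<omega>. path_min (X \<omega>)) \<in> borel_measurable P"
  by (rule borel_measurableI_ge) (simp add: path_min_ge_iff path_ge_events)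

lemma min_tail_path_min: "min_tail v = prob {\<omega> \<in> space P. v \<le> path_min (X \<omega>)}"
  by (simp add: min_tail_def path_min_ge_iff)

text \<open>Strict exceedance at \<open>x\<close> lies between nonstrict exceedance at any
  \<open>y > x\<close> and at \<open>x\<close>. Continuity of the limit in \<open>x\<close> closes
  the gap, without showing that the law of the minimum has no atoms.\<close>

lemma exceedance_ratio_tendsto:
  assumes pos: "min_energy cov > 0" and x: "0 \<le> x"
  shows "((\<lambda>u. prob {\<omega> \<in> space P. u + x / u < path_min (X \<omega>)} / min_tail u) \<longlongrightarrow> exp (- (x / min_energy cov))) at_top"
proof (rule order_tendstoI)
  fix l assume l: "l < exp (- (x / min_energy cov))"
  have "((\<lambda>y. exp (- (y / min_energy cov))) \<longlongrightarrow> exp (- (x / min_energy cov))) (at_right x)"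
    using pos by (intro tendsto_intros) auto
  then have "\<forall>\<^sub>F y in at_right x. l < exp (- (y / min_energy cov)) \<and> x < y"
    using l by (intro eventually_conj eventually_at_right_less order_tendstoD) auto
  then obtain y where y: "l < exp (- (y / min_energy cov))" "x < y"
    using eventually_happens'[OF trivial_limit_at_right_real] by auto
  have "\<forall>\<^sub>F u in at_top. l < min_tail (u + y / u) / min_tail u"
    using x y by (intro order_tendstoD[OF min_tail_ratio_tendsto[OF pos]]) auto
  then show "\<forall>\<^sub>F u in at_top. l < prob {\<omega> \<in> space P. u + x / u < path_min (X \<omega>)} / min_tail u"
    using eventually_gt_at_top[of 0]
  proof eventually_elim
    case (elim u)
    have "u + x / u < u + y / u" using y elim by (simp add: divide_strict_right_mono)
    then have "min_tail (u + y / u) \<le> prob {\<omega> \<in> space P. u + x / u < path_min (X \<omega>)}"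
      unfolding min_tail_path_min by (intro finite_measure_mono) auto
    then have "min_tail (u + y / u) / min_tail u \<le> prob {\<omega> \<in> space P. u + x / u < path_min (X \<omega>)} / min_tail u"
      by (intro divide_right_mono min_tail_nonneg)
    with elim show ?case by linarith
  qed
next
  fix l assume l: "exp (- (x / min_energy cov)) < l"
  have "\<forall>\<^sub>F u in at_top. min_tail (u + x / u) / min_tail u < l"
    using x l by (intro order_tendstoD[OF min_tail_ratio_tendsto[OF pos]]) auto
  then show "\<forall>\<^sub>F u in at_top. prob {\<omega> \<in> space P. u + x / u < path_min (X \<omega>)} / min_tail u < l"
  proof eventually_elim
    case (elim u)
    have "prob {\<omega> \<in> space P. u + x / u < path_min (X \<omega>)} \<le> min_tail (u + x / u)"
      unfolding min_tail_path_min by (intro finite_measure_mono) auto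
    then have "prob {\<omega> \<in> space P. u + x / u < path_min (X \<omega>)} / min_tail u \<le> min_tail (u + x / u) / min_tail u"
      by (intro divide_right_mono min_tail_nonneg)
    with elim show ?case by linarith
  qed
qed

lemma conditional_exceedance_tendsto:
  assumes pos: "min_energy cov > 0" and x: "0 \<le> x"
  shows "((\<lambda>u. prob {\<omega> \<in> space P. u + x / u < path_min (X \<omega>)} / prob {\<omega> \<in> space P. u < path_min (X \<omega>)})
    \<longlongrightarrow> exp (- (x / min_energy cov))) at_top"
proof (rule Lim_transform_eventually)
  \<comment> \<open>The instance \<open>x = 0\<close> of the ratio limit exchanges
    \<open>min_tail u\<close> for the strict exceedance probability in the denominator.\<close>
  have "((\<lambda>u. (prob {\<omega> \<in> space P. u + x / u < path_min (X \<omega>)} / min_tail u) / (prob {\<omega> \<in> space P. u + 0 / u < path_min (X \<omega>)} / min_tail u))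
    \<longlongrightarrow> exp (- (x / min_energy cov)) / exp (- (0 / min_energy cov))) at_top"
    by (intro tendsto_divide exceedance_ratio_tendsto pos x) auto
  then show "((\<lambda>u. (prob {\<omega> \<in> space P. u + x / u < path_min (X \<omega>)} / min_tail u) / (prob {\<omega> \<in> space P. u + 0 / u < path_min (X \<omega>)} / min_tail u))
    \<longlongrightarrow> exp (- (x / min_energy cov))) at_top" by simp
  show "\<forall>\<^sub>F u in at_top. (prob {\<omega> \<in> space P. u + x / u < path_min (X \<omega>)} / min_tail u) / (prob {\<omega> \<in> space P. u + 0 / u < path_min (X \<omega>)} / min_tail u)
    = prob {\<omega> \<in> space P. u + x / u < path_min (X \<omega>)} / prob {\<omega> \<in> space P. u < path_min (X \<omega>)}"
    using min_tail_eventually_pos[OF pos] by eventually_elim simp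
qed

text \<open>Monotonicity carries positivity from high levels to every \<open>u\<close>. The
  sequential criterion for weak convergence asks every conditional law along the sequence to be a
  probability measure.\<close>

lemma exceedance_pos:
  assumes pos: "min_energy cov > 0"
  shows "0 < prob {\<omega> \<in> space P. u < path_min (X \<omega>)}"
proof -
  have "\<forall>\<^sub>F v in at_top. 0 < min_tail v \<and> u < v"
    by (intro eventually_conj min_tail_eventually_pos pos eventually_gt_at_top)
  then obtain v where v: "0 < min_tail v" "u < v"
    using eventually_happens'[OF trivial_limit_at_top_linorder] by auto
  have "min_tail v \<le> prob {\<omega> \<in> space P. u < path_min (X \<omega>)}"
    unfolding min_tail_path_min using v(2) by (intro finite_measure_mono) auto
  with v(1) show ?thesis by linarith
qed

end

section \<open>Distribution functions of the conditional law and of the limit\<close>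

lemma (in prob_space) cond_law_cdf:
  assumes [measurable]: "M' \<in> borel_measurable M" and u: "0 < u" and pos: "0 < prob {\<omega> \<in> space M. u < M' \<omega>}"
  shows "cdf (cond_law M (\<lambda>\<omega>. u * (M' \<omega> - u)) (\<lambda>\<omega>. M' \<omega> > u)) x =
    (if x < 0 then 0 else 1 - prob {\<omega> \<in> space M. u + x / u < M' \<omega>} / prob {\<omega> \<in> space M. u < M' \<omega>})"
proof -
  let ?A = "{\<omega> \<in> space M. u < M' \<omega>}" and ?B = "{\<omega> \<in> space M. u * (M' \<omega> - u) \<le> x}"
  have "cdf (cond_law M (\<lambda>\<omega>. u * (M' \<omega> - u)) (\<lambda>\<omega>. M' \<omega> > u)) x = measure (uniform_measure M ?A) ?B"
    unfolding cdf_def cond_law_def by (subst measure_distr) (auto intro!: arg_cong2[of _ _ _ _ measure])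
  also have "\<dots> = prob (?A \<inter> ?B) / prob ?A"
    using pos by (subst measure_uniform_measure) (auto simp: emeasure_eq_measure)
  finally have 1: "cdf (cond_law M (\<lambda>\<omega>. u * (M' \<omega> - u)) (\<lambda>\<omega>. M' \<omega> > u)) x = prob (?A \<inter> ?B) / prob ?A" .
  show ?thesis
  proof (cases "x < 0")
    case True
    \<comment> \<open>The rescaled excess is positive on the conditioning event, so the conditional
      law puts no mass on the negative half-line.\<close>
    have "0 < u * (m - u)" if "u < m" for m using u that by simp
    with True have "?A \<inter> ?B = {}" by force
    with 1 True show ?thesis by simp
  next
    case False
    have iff: "u * (m - u) \<le> x \<longleftrightarrow> \<not> u + x / u < m" for m
      using u by (simp add: field_simps not_less)
    have le: "u \<le> u + x / u" using False u by simp
    have "?A \<inter> ?B = ?A - {\<omega> \<in> space M. u + x / u < M' \<omega>}" unfolding iff by auto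
    also have "prob \<dots> = prob ?A - prob {\<omega> \<in> space M. u + x / u < M' \<omega>}"
      using le by (intro finite_measure_Diff) auto
    finally show ?thesis using 1 pos False by (simp add: diff_divide_distrib)
  qed
qed

lemma (in prob_space) scaled_exponential_cdf:
  assumes D: "distributed M lborel \<xi> (exponential_density 1)" and s: "0 < s"
  shows "cdf (distr M borel (\<lambda>\<omega>. s * \<xi> \<omega>)) x = (if x < 0 then 0 else 1 - exp (- (x / s)))"
proof -
  have [measurable]: "\<xi> \<in> borel_measurable M" using D by (auto simp: distributed_def)
  have "cdf (distr M borel (\<lambda>\<omega>. s * \<xi> \<omega>)) x = prob {\<omega> \<in> space M. s * \<xi> \<omega> \<le> x}"
    unfolding cdf_def by (subst measure_distr) (auto intro!: arg_cong[of _ _ prob])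
  also have "{\<omega> \<in> space M. s * \<xi> \<omega> \<le> x} = {\<omega> \<in> space M. \<xi> \<omega> \<le> x / s}"
    using s by (auto simp: field_simps)
  finally have 1: "cdf (distr M borel (\<lambda>\<omega>. s * \<xi> \<omega>)) x = prob {\<omega> \<in> space M. \<xi> \<omega> \<le> x / s}" .
  show ?thesis
  proof (cases "x < 0")
    case True
    \<comment> \<open>The exponential distribution formula covers only nonnegative arguments;
      negative ones are dominated by its value 0 at the origin.\<close>
    have "prob {\<omega> \<in> space M. \<xi> \<omega> \<le> x / s} \<le> prob {\<omega> \<in> space M. \<xi> \<omega> \<le> 0}"
      using True s by (intro finite_measure_mono) (auto intro: order_trans[OF _ less_imp_le[OF divide_neg_pos]])
    also have "\<dots> = 0" using exponential_distributedD_le[OF D, of 0] by simp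
    finally show ?thesis using 1 True measure_nonneg[of M] by (simp add: antisym)
  next
    case False
    then show ?thesis using 1 exponential_distributedD_le[OF D, of "x / s"] s by simp
  qed
qed

theorem theorem2p1:
  fixes P :: "'w measure"
    and X :: "'w \<Rightarrow> ('k::metric_space \<Rightarrow>\<^sub>C real)"
    and R :: "'k \<Rightarrow> 'k \<Rightarrow> real"
    and M :: "'w \<Rightarrow> real"
    and sigma2 :: real
    and N :: "'v measure"
    and \<xi> :: "'v \<Rightarrow> real"
  assumes K: "compact (UNIV :: 'k set)"
    and P: "prob_space P"
    and X_meas: "X \<in> borel_measurable P"
    and X_gauss: "centred_gaussian_process P (\<lambda>\<omega> t. apply_bcontfun (X \<omega>) t)"
    and R_def: "R = covariance_kernel P (\<lambda>\<omega> t. apply_bcontfun (X \<omega>) t)"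
    and M_def: "M = (\<lambda>\<omega>. path_min (X \<omega>))"
    and sigma2_def: "sigma2 = min_energy R"
    and sigma2_pos: "sigma2 > 0"
    and N: "prob_space N"
    and xi: "distributed N lborel \<xi> (exponential_density 1)"
  shows "weak_conv_along
           (\<lambda>u. cond_law P (\<lambda>\<omega>. u * (M \<omega> - u)) (\<lambda>\<omega>. M \<omega> > u))
           (distr N borel (\<lambda>\<omega>. sigma2 * \<xi> \<omega>))
           at_top"
proof -
  interpret P: prob_space P by fact
  interpret N: prob_space N by fact
  interpret G: gaussian_element P X
    by unfold_locales (use K X_meas X_gauss in auto)
  have pos: "min_energy G.cov > 0" using sigma2_pos by (simp add: sigma2_def R_def)
  note [measurable] = G.path_min_measurable
  have Mm[measurable]: "M \<in> borel_measurable P" unfolding M_def by measurable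
  have A: "0 < P.prob {\<omega> \<in> space P. u < M \<omega>}" for u
    unfolding M_def by (rule G.exceedance_pos[OF pos])
  have [measurable]: "\<xi> \<in> borel_measurable N" using xi by (auto simp: distributed_def)
  have rd: "real_distribution (distr N borel (\<lambda>\<omega>. sigma2 * \<xi> \<omega>))"
    by (rule N.real_distribution_distr) simp
  have rdc: "real_distribution (cond_law P (\<lambda>\<omega>. u * (M \<omega> - u)) (\<lambda>\<omega>. M \<omega> > u))" for u
  proof -
    have "prob_space (uniform_measure P {\<omega> \<in> space P. u < M \<omega>})"
      using A[of u] by (intro prob_space_uniform_measure) (auto simp: P.emeasure_eq_measure)
    then show ?thesis
      unfolding cond_law_def by (intro prob_space.real_distribution_distr) auto
  qed
  \<comment> \<open>The limiting distribution function is continuous, so convergence is obtained at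
    every \<open>x\<close>. Arbitrary sequences of levels are treated because the
    distribution-function criterion is sequential.\<close>
  have cdf: "(\<lambda>n. cdf (cond_law P (\<lambda>\<omega>. u n * (M \<omega> - u n)) (\<lambda>\<omega>. M \<omega> > u n)) x)
      \<longlonglongrightarrow> cdf (distr N borel (\<lambda>\<omega>. sigma2 * \<xi> \<omega>)) x" if u: "filterlim u at_top sequentially" for u :: "nat \<Rightarrow> real" and x
  proof (rule Lim_transform_eventually)
    show "(\<lambda>n. if x < 0 then 0 else 1 - P.prob {\<omega> \<in> space P. u n + x / u n < M \<omega>} / P.prob {\<omega> \<in> space P. u n < M \<omega>})
       \<longlonglongrightarrow> cdf (distr N borel (\<lambda>\<omega>. sigma2 * \<xi> \<omega>)) x"
    proof (cases "x < 0")
      case False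
      have "(\<lambda>n. P.prob {\<omega> \<in> space P. u n + x / u n < M \<omega>} / P.prob {\<omega> \<in> space P. u n < M \<omega>}) \<longlonglongrightarrow> exp (- (x / sigma2))"
        using filterlim_compose[OF G.conditional_exceedance_tendsto[OF pos, of x] u] False
        by (simp add: M_def sigma2_def R_def)
      from tendsto_diff[OF tendsto_const[of 1] this] False show ?thesis
        by (simp add: N.scaled_exponential_cdf[OF xi sigma2_pos])
    qed (simp add: N.scaled_exponential_cdf[OF xi sigma2_pos])
    \<comment> \<open>The formula for the conditional distribution function presupposes a positive
      level, which holds from some index on.\<close>
    have "\<forall>\<^sub>F n in sequentially. 0 < u n"
      using u eventually_gt_at_top[of 0] by (rule eventually_compose_filterlim[rotated])
    then show "\<forall>\<^sub>F n in sequentially. (if x < 0 then 0 else 1 - P.prob {\<omega> \<in> space P. u n + x / u n < M \<omega>} / P.prob {\<omega> \<in> space P. u n < M \<omega>})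
       = cdf (cond_law P (\<lambda>\<omega>. u n * (M \<omega> - u n)) (\<lambda>\<omega>. M \<omega> > u n)) x"
      by eventually_elim (simp add: P.cond_law_cdf[OF Mm _ A])
  qed
  show ?thesis
    unfolding weak_conv_along_def
  proof (intro allI impI tendsto_at_topI_sequentially)
    fix f :: "real \<Rightarrow> real" and u :: "nat \<Rightarrow> real"
    assume f: "continuous_on UNIV f \<and> bounded (range f)" and u: "filterlim u at_top sequentially"
    have "weak_conv_m (\<lambda>n. cond_law P (\<lambda>\<omega>. u n * (M \<omega> - u n)) (\<lambda>\<omega>. M \<omega> > u n)) (distr N borel (\<lambda>\<omega>. sigma2 * \<xi> \<omega>))"
      unfolding weak_conv_m_def weak_conv_def using cdf[OF u] by simp
    then have "weak_conv_along (\<lambda>n. cond_law P (\<lambda>\<omega>. u n * (M \<omega> - u n)) (\<lambda>\<omega>. M \<omega> > u n)) (distr N borel (\<lambda>\<omega>. sigma2 * \<xi> \<omega>)) sequentially"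
      by (subst weak_conv_along_sequentially[OF rdc rd])
    with f show "(\<lambda>n. \<integral>x. f x \<partial>cond_law P (\<lambda>\<omega>. u n * (M \<omega> - u n)) (\<lambda>\<omega>. M \<omega> > u n)) \<longlonglongrightarrow> (\<integral>x. f x \<partial>distr N borel (\<lambda>\<omega>. sigma2 * \<xi> \<omega>))"
      unfolding weak_conv_along_def by blast
  qed
qed

end
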